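(* Let $d\ge 1$ and let $X$ and $Y$ be independent identically distributed log-concave random vectors in $\mathbb{R}^d$. (1) If $\alpha\in[2,\infty]$, then $$h_\alpha(X-Y)\le h_\alpha(X)+d\log 2,$$ with equality when $X$ has the exponential distribution with density $x\mapsto \mathbf{1}_{(0,\infty)^d}(x)\,e^{-\sum_{i=1}^d x_i}$. (2) If $\alpha\in[0,2]$, then $$h_\alpha(X-Y)\le h_\alpha(X)+d\log\alpha^{\frac{1}{\alpha-1}}.$$
   Context: A random vector in $\mathbb{R}^d$ is log-concave if it has a density $f:\mathbb{R}^d\to[0,\infty)$ with respect to Lebesgue measure such that $f((1-t)x+ty)\ge f(x)^{1-t}f(y)^t$ for all $t\in(0,1)$ and $x,y\in\mathbb{R}^d$. Rényi entropy: for an $\mathbb{R}^d$-valued random variable $Y$ with density $f$ and $\alpha\in(0,1)\cup(1,\infty)$, $h_\alpha(Y)=\frac{1}{1-\alpha}\log\int_{\mathbb{R}^d}f^\alpha(x)\,dx$; $h_0(Y)=\log|\{x:f(x)>0\}|$ with $|\cdot|$ Lebesgue volume (possibly $+\infty$); $h_1(Y)=-\int f(x)\log f(x)\,dx$; $h_\infty(Y)=-\log\|f\|_\infty$, where $\|f\|_\infty$ is the $L_\infty$ norm with respect to Lebesgue measure. Conventions: $\alpha^{\frac1{\alpha-1}}$ is interpreted as $e$ for $\alpha=1$ and as $+\infty$ for $\alpha=0$ (so that the bound in (2) is trivial for $\alpha=0$). Here $\log$ is the logarithm to any fixed base greater than $1$ (e.g. natural). *)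

theory Defs
  imports "HOL-Probability.Probability"
begin

definition log_concave_fun :: "('a::real_vector \<Rightarrow> real) \<Rightarrow> bool" where
  "log_concave_fun f \<longleftrightarrow>
     (\<forall>x y. \<forall>t\<in>{0<..<1}. f ((1 - t) *\<^sub>R x + t *\<^sub>R y) \<ge> f x powr (1 - t) * f y powr t)"

definition log_concave_vector :: "'s measure \<Rightarrow> ('s \<Rightarrow> 'a::euclidean_space) \<Rightarrow> bool" where
  "log_concave_vector M X \<longleftrightarrow>
     (\<exists>f. (\<forall>x. 0 \<le> f x) \<and> log_concave_fun f \<and> distributed M lborel X (\<lambda>x. ennreal (f x)))"

text \<open>Logarithm to base \<open>b > 1\<close> on \<open>[0, \<infinity>]\<close>, with \<open>log 0 = -\<infinity>\<close> and \<open>log \<infinity> = \<infinity>\<close>.\<close>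

definition elog :: "real \<Rightarrow> ennreal \<Rightarrow> ereal" where
  "elog b x = (if x = 0 then - \<infinity> else if x = \<infinity> then \<infinity> else ereal (log b (enn2real x)))"

text \<open>
  Entropy of order \<open>\<alpha> \<in> [0, \<infinity>]\<close>, with logarithms to base \<open>b\<close>, of a nonnegative density \<open>f\<close>.
  For \<open>\<alpha> = 1\<close> the integral of \<open>- f log f\<close> is taken in the extended sense, as the integral of the
  positive part minus that of the negative part (\<open>ennreal\<close> sends negative reals to \<open>0\<close>).
  This agrees with the usual value whenever one of the two parts has a finite integral.
\<close>

definition renyi_entropy_density :: "real \<Rightarrow> ennreal \<Rightarrow> ('a::euclidean_space \<Rightarrow> real) \<Rightarrow> ereal" where
  "renyi_entropy_density b \<alpha> f =
     (if \<alpha> = 0 then elog b (emeasure lborel {x. f x > 0})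
      else if \<alpha> = 1 then
        enn2ereal (\<integral>\<^sup>+x. ennreal (- (f x * log b (f x))) \<partial>lborel)
        - enn2ereal (\<integral>\<^sup>+x. ennreal (f x * log b (f x)) \<partial>lborel)
      else if \<alpha> = \<infinity> then - elog b (esssup lborel (\<lambda>x. ennreal (f x)))
      else ereal (1 / (1 - enn2real \<alpha>)) *
        elog b (\<integral>\<^sup>+x. ennreal (f x powr enn2real \<alpha>) \<partial>lborel))"

text \<open>
  Entropy of a random vector having a density; \<open>RN_deriv\<close> selects a version of the density,
  and the value does not depend on the version.
\<close>

definition renyi_entropy ::
    "'s measure \<Rightarrow> real \<Rightarrow> ennreal \<Rightarrow> ('s \<Rightarrow> 'a::euclidean_space) \<Rightarrow> ereal" where
  "renyi_entropy M b \<alpha> Y =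
     renyi_entropy_density b \<alpha> (\<lambda>x. enn2real (RN_deriv lborel (distr M lborel Y) x))"

text \<open>\<open>\<alpha>\<^bsup>1/(\<alpha>-1)\<^esup>\<close>, with its limiting values \<open>e\<close> at \<open>\<alpha> = 1\<close> and \<open>+\<infinity>\<close> at \<open>\<alpha> = 0\<close>.\<close>

definition renyi_const :: "real \<Rightarrow> ennreal" where
  "renyi_const \<alpha> =
     (if \<alpha> = 0 then \<infinity> else if \<alpha> = 1 then ennreal (exp 1) else ennreal (\<alpha> powr (1 / (\<alpha> - 1))))"

definition exp_density :: "real ^ 'n \<Rightarrow> real" where
  "exp_density x = indicator {x. \<forall>i. 0 < x $ i} x * exp (- (\<Sum>i\<in>UNIV. x $ i))"

end

theory Submission
  imports Defs
begin

text \<open>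
  Let \<open>f\<close> be the log-concave density of \<open>X\<close>. Then \<open>X - Y\<close> has density \<open>g z = \<integral> f (z + y) f y dy\<close>, the
  autocorrelation of \<open>f\<close>. The number \<open>c = \<integral> f\<^sup>2\<close> ties the two densities together: it is both the
  value \<open>g 0\<close> and the quantity behind \<open>h\<^sub>2(X) = - log c\<close>. A single value of a log-concave density bounds its
  entropies, so \<open>h\<^sub>\<alpha>(X - Y)\<close> can be compared with \<open>h\<^sub>2(X)\<close>, and everything reduces to comparing entropies of
  different orders of the one density \<open>f\<close>.

  Two comparisons are needed. Log-concavity along the ray from a point \<open>x\<^sub>0\<close>, in the form
  \<open>g ((1 - \<alpha>) x\<^sub>0 + \<alpha> x) \<ge> g x\<^sub>0\<^bsup>1 - \<alpha>\<^esup> g x\<^bsup>\<alpha>\<^esup>\<close> (or with \<open>1/\<alpha>\<close> when \<open>\<alpha> > 1\<close>), integrates to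
  \<open>h\<^sub>\<alpha>(g) \<le> - log (g x\<^sub>0) + d log \<alpha> / (\<alpha> - 1)\<close>; at \<open>x\<^sub>0 = 0\<close> this bounds \<open>h\<^sub>\<alpha>(X - Y)\<close> by
  \<open>h\<^sub>2(X) + d log \<alpha> / (\<alpha> - 1)\<close> (\<open>integral_powr_upper\<close>, \<open>integral_powr_lower\<close>, \<open>entropy_upper\<close>).

  For \<open>\<alpha> \<le> 2\<close> the entropy is nonincreasing in its order, so \<open>h\<^sub>2(X) \<le> h\<^sub>\<alpha>(X)\<close> and the second claim
  follows. For \<open>\<alpha> > 2\<close> one needs the reverse estimate
  \<open>h\<^sub>2(X) \<le> h\<^sub>\<alpha>(X) + d (log 2 - log \<alpha> / (\<alpha> - 1))\<close>, which says that \<open>p \<mapsto> p\<^sup>d \<integral> f\<^sup>p\<close> is log-concave at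
  the three points \<open>1, 2, \<alpha>\<close> (\<open>integral_powr_interpolation\<close>). It is an instance of the
  Prekopa-Leindler inequality, because \<open>p\<^sup>d \<integral> f\<^sup>p = \<integral> f (x / p)\<^sup>p dx\<close> and the integrand is jointly
  log-concave in \<open>(x, p)\<close>. Adding the two bounds, the terms \<open>d log \<alpha> / (\<alpha> - 1)\<close> cancel and leave
  \<open>d log 2\<close>.

  The Prekopa-Leindler inequality (\<open>prekopa_leindler\<close>) is also what makes \<open>g\<close> log-concave. It is
  derived from the one-dimensional Brunn-Minkowski inequality by integrating over level sets, and
  then carried to higher dimension coordinate by coordinate.

  For the exponential density, \<open>g\<close> is \<open>c\<close> times \<open>exp (- \<Sum> \<bar>z\<^sub>i\<bar>)\<close> and both integrals in the claim are
  computed by dilating the variable, which shows that the first bound is attained.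
\<close>

section \<open>The Brunn-Minkowski inequality on the real line\<close>

lemma emeasure_lborel_translate:
  fixes A :: "real set"
  assumes [measurable]: "A \<in> sets borel"
  shows "emeasure lborel {x. x - b \<in> A} = emeasure lborel A"
proof -
  have "emeasure lborel A = emeasure (distr lborel borel ((+) (-b))) A"
    by (simp add: lborel_distr_plus)
  also have "\<dots> = emeasure lborel {x. x - b \<in> A}"
    by (subst emeasure_distr) (auto simp: vimage_def)
  finally show ?thesis by simp
qed

lemma emeasure_lborel_dilate:
  fixes A :: "real set"
  assumes [measurable]: "A \<in> sets borel" and "0 < c"
  shows "emeasure lborel {x. x / c \<in> A} = ennreal c * emeasure lborel A"
proof -
  have "emeasure lborel {x. x / c \<in> A} = (\<integral>\<^sup>+x. indicator {x. x / c \<in> A} x \<partial>lborel)"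
    by (subst nn_integral_indicator) measurable
  also have "\<dots> = ennreal c * (\<integral>\<^sup>+x. indicator {x. x / c \<in> A} (0 + c * x) \<partial>lborel)"
    using assms(2) by (subst nn_integral_real_affine[of _ c 0]) auto
  also have "(\<integral>\<^sup>+x. indicator {x. x / c \<in> A} (0 + c * x) \<partial>lborel) = (\<integral>\<^sup>+x. indicator A x \<partial>lborel)"
    using assms(2) by (intro nn_integral_cong) (auto simp: indicator_def)
  finally show ?thesis by simp
qed

text \<open>
  The translates \<open>A + b\<close> and \<open>a + B\<close> both lie in \<open>C\<close>. When \<open>a\<close> is close to the top of \<open>A\<close> and \<open>b\<close> is close
  to the bottom of \<open>B\<close>, they overlap only in a short interval, so their measures add up to at most
  the measure of \<open>C\<close> plus the length of that interval.
\<close>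

lemma brunn_minkowski_real_bounded:
  fixes A B C :: "real set"
  assumes [measurable]: "A \<in> sets borel" "B \<in> sets borel" "C \<in> sets borel"
    and ne: "A \<noteq> {}" "B \<noteq> {}" and bd: "bdd_above A" "bdd_below B"
    and sum: "\<And>a b. a \<in> A \<Longrightarrow> b \<in> B \<Longrightarrow> a + b \<in> C"
  shows "emeasure lborel A + emeasure lborel B \<le> emeasure lborel C"
proof (rule ennreal_le_epsilon)
  fix e :: real assume e: "0 < e"
  define d where "d = e / 2"
  have d: "0 < d" using e by (simp add: d_def)
  obtain a where a: "a \<in> A" "Sup A - d < a"
    using less_cSup_iff[OF ne(1) bd(1), of "Sup A - d"] d by auto
  obtain b where b: "b \<in> B" "b < Inf B + d"
    using cInf_less_iff[OF ne(2) bd(2), of "Inf B + d"] d by auto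
  define D where "D = A \<inter> {..< Sup A - 2 * d}"
  have [measurable]: "D \<in> sets borel" by (simp add: D_def)
  have "emeasure lborel A \<le> emeasure lborel (D \<union> {Sup A - 2 * d .. Sup A})"
    using cSup_upper[OF _ bd(1)] by (intro emeasure_mono) (auto simp: D_def)
  also have "\<dots> \<le> emeasure lborel D + emeasure lborel {Sup A - 2 * d .. Sup A}"
    by (intro emeasure_subadditive) auto
  also have "emeasure lborel {Sup A - 2 * d .. Sup A} = ennreal e"
    using d by (simp add: d_def)
  finally have 1: "emeasure lborel A \<le> emeasure lborel D + ennreal e" .
  have disj: "{x. x - b \<in> D} \<inter> {x. x - a \<in> B} = {}"
  proof safe
    fix x assume x: "x - b \<in> D" "x - a \<in> B"
    have "Inf B \<le> x - a" by (rule cInf_lower[OF x(2) bd(2)])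
    then show "x \<in> {}" using x(1) a b by (auto simp: D_def)
  qed
  have "emeasure lborel D + emeasure lborel B
      = emeasure lborel {x. x - b \<in> D} + emeasure lborel {x. x - a \<in> B}"
    by (simp add: emeasure_lborel_translate)
  also have "\<dots> = emeasure lborel ({x. x - b \<in> D} \<union> {x. x - a \<in> B})"
    by (rule plus_emeasure[OF _ _ disj]) auto
  also have "\<dots> \<le> emeasure lborel C"
  proof (intro emeasure_mono)
    show "{x. x - b \<in> D} \<union> {x. x - a \<in> B} \<subseteq> C"
      using sum[OF a(1)] sum[OF _ b(1)] by (force simp: D_def)
  qed auto
  finally have 2: "emeasure lborel D + emeasure lborel B \<le> emeasure lborel C" .
  have "emeasure lborel A + emeasure lborel B \<le> (emeasure lborel D + ennreal e) + emeasure lborel B"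
    by (rule add_right_mono[OF 1])
  also have "\<dots> = (emeasure lborel D + emeasure lborel B) + ennreal e" by (simp add: ac_simps)
  also have "\<dots> \<le> emeasure lborel C + ennreal e" by (rule add_right_mono[OF 2])
  finally show "emeasure lborel A + emeasure lborel B \<le> emeasure lborel C + ennreal e" .
qed

text \<open>
  Cutting \<open>A\<close> from above and \<open>B\<close> from below gives increasing unions to which the bounded case applies.
\<close>

lemma brunn_minkowski_real:
  fixes A B C :: "real set"
  assumes [measurable]: "A \<in> sets borel" "B \<in> sets borel" "C \<in> sets borel"
    and ne: "A \<noteq> {}" "B \<noteq> {}"
    and sum: "\<And>a b. a \<in> A \<Longrightarrow> b \<in> B \<Longrightarrow> a + b \<in> C"
  shows "emeasure lborel A + emeasure lborel B \<le> emeasure lborel C"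
proof -
  define A' where "A' n = A \<inter> {.. real n}" for n
  define B' where "B' n = B \<inter> {- real n ..}" for n
  have [measurable]: "A' n \<in> sets borel" "B' n \<in> sets borel" for n
    by (simp_all add: A'_def B'_def)
  have UN: "(\<Union>n. A' n) = A" "(\<Union>n. B' n) = B"
  proof -
    have "\<exists>n. x \<le> real n" "\<exists>n. - real n \<le> x" for x
      using real_arch_simple[of x] real_arch_simple[of "-x"] by (auto simp: minus_le_iff)
    then show "(\<Union>n. A' n) = A" "(\<Union>n. B' n) = B" by (auto simp: A'_def B'_def)
  qed
  have "(\<lambda>n. emeasure lborel (A' n)) \<longlonglongrightarrow> emeasure lborel (\<Union>n. A' n)"
       "(\<lambda>n. emeasure lborel (B' n)) \<longlonglongrightarrow> emeasure lborel (\<Union>n. B' n)"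
    by (intro Lim_emeasure_incseq; force simp: incseq_def A'_def B'_def)+
  then have lim: "(\<lambda>n. emeasure lborel (A' n) + emeasure lborel (B' n))
      \<longlonglongrightarrow> emeasure lborel A + emeasure lborel B"
    unfolding UN by (intro tendsto_add) auto
  obtain a b where ab: "a \<in> A" "b \<in> B" using ne by auto
  show ?thesis
  proof (rule tendsto_upperbound[OF lim])
    show "\<forall>\<^sub>F n in sequentially. emeasure lborel (A' n) + emeasure lborel (B' n) \<le> emeasure lborel C"
    proof (rule eventually_sequentiallyI)
      fix n assume n: "nat \<lceil>max a (- b)\<rceil> \<le> n"
      then have "a \<in> A' n" "b \<in> B' n" using ab by (auto simp: A'_def B'_def)
      then show "emeasure lborel (A' n) + emeasure lborel (B' n) \<le> emeasure lborel C"
        by (intro brunn_minkowski_real_bounded) (auto simp: A'_def B'_def intro: sum)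
    qed
  qed simp
qed

lemma brunn_minkowski_real_convex:
  fixes A B C :: "real set"
  assumes [measurable]: "A \<in> sets borel" "B \<in> sets borel" "C \<in> sets borel"
    and ne: "A \<noteq> {}" "B \<noteq> {}" and t: "0 < t" "t < 1"
    and comb: "\<And>a b. a \<in> A \<Longrightarrow> b \<in> B \<Longrightarrow> (1 - t) * a + t * b \<in> C"
  shows "ennreal (1 - t) * emeasure lborel A + ennreal t * emeasure lborel B \<le> emeasure lborel C"
proof -
  have "emeasure lborel {x. x / (1 - t) \<in> A} + emeasure lborel {x. x / t \<in> B} \<le> emeasure lborel C"
  proof (rule brunn_minkowski_real)
    obtain a b where "a \<in> A" "b \<in> B" using ne by auto
    then have "(1 - t) * a \<in> {x. x / (1 - t) \<in> A}" "t * b \<in> {x. x / t \<in> B}" using t by auto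
    then show "{x. x / (1 - t) \<in> A} \<noteq> {}" "{x. x / t \<in> B} \<noteq> {}" by blast+
    fix a b assume "a \<in> {x. x / (1 - t) \<in> A}" "b \<in> {x. x / t \<in> B}"
    then show "a + b \<in> C" using comb[of "a / (1 - t)" "b / t"] t by simp
  qed auto
  then show ?thesis using t by (simp add: emeasure_lborel_dilate)
qed

section \<open>The Prekopa-Leindler inequality\<close>

text \<open>
  This is the inequality \<open>a\<^bsup>1 - t\<^esup> b\<^bsup>t\<^esup> \<le> c\<close> in the extended half-line, with the convention
  \<open>0 \<cdot> \<infinity> = 0\<close>. Testing it on reals strictly below \<open>a\<close> and \<open>b\<close> avoids powers of \<open>\<infinity>\<close>, and the integrals of
  sections may well be infinite when the dimension is raised.
\<close>

definition gmean_le :: "real \<Rightarrow> ennreal \<Rightarrow> ennreal \<Rightarrow> ennreal \<Rightarrow> bool" where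
  "gmean_le t a b c \<longleftrightarrow>
     (\<forall>r s. 0 < r \<longrightarrow> 0 < s \<longrightarrow> ennreal r < a \<longrightarrow> ennreal s < b \<longrightarrow>
        ennreal (r powr (1 - t) * s powr t) \<le> c)"

lemma layer_integral_less:
  assumes "0 < A"
  shows "ennreal A * (\<integral>\<^sup>+s. indicator {s. 0 < s \<and> s < 1 \<and> ennreal (A * s) < w} s \<partial>lborel) = min w (ennreal A)"
proof (cases "ennreal A \<le> w")
  case True
  have *: "{s. 0 < s \<and> s < 1 \<and> ennreal (A * s) < w} = {0<..<1}"
    using assms True by (auto intro!: less_le_trans[OF _ True] simp: ennreal_less_iff)
  show ?thesis using assms True unfolding * by (simp add: min_def)
next
  case False
  then obtain v where v: "w = ennreal v" "0 \<le> v" "v < A"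
    using assms by (cases w) (auto simp: top_unique not_le ennreal_less_iff)
  have *: "{s. 0 < s \<and> s < 1 \<and> ennreal (A * s) < w} = {0<..<v / A}"
  proof (intro set_eqI iffI)
    fix s assume s: "s \<in> {0<..<v / A}"
    moreover have "v / A < 1" using assms v by simp
    then have "s < 1" using s by simp
    ultimately show "s \<in> {s. 0 < s \<and> s < 1 \<and> ennreal (A * s) < w}"
      using assms v by (auto simp: ennreal_less_iff field_simps)
  qed (use assms v in \<open>auto simp: ennreal_less_iff field_simps\<close>)
  show ?thesis using assms v unfolding * by (simp add: min_def ennreal_mult[symmetric])
qed

lemma layer_integral_le:
  assumes "0 < A"
  shows "ennreal A * (\<integral>\<^sup>+s. indicator {s. 0 < s \<and> s < 1 \<and> ennreal (A * s) \<le> w} s \<partial>lborel) \<le> w"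
proof (cases w)
  case (real v)
  have "(\<integral>\<^sup>+s. indicator {s. 0 < s \<and> s < 1 \<and> ennreal (A * s) \<le> w} s \<partial>lborel)
      \<le> (\<integral>\<^sup>+s. indicator {0..v / A} s \<partial>lborel)"
    using assms real by (intro nn_integral_mono) (auto simp: indicator_def field_simps)
  then have "(\<integral>\<^sup>+s. indicator {s. 0 < s \<and> s < 1 \<and> ennreal (A * s) \<le> w} s \<partial>lborel) \<le> ennreal (v / A)"
    using assms real by simp
  then have "ennreal A * (\<integral>\<^sup>+s. indicator {s. 0 < s \<and> s < 1 \<and> ennreal (A * s) \<le> w} s \<partial>lborel)
     \<le> ennreal A * ennreal (v / A)" by (rule mult_left_mono) simp
  then show ?thesis using assms real by (simp add: ennreal_mult[symmetric])
qed simp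

lemma layer_cake_less:
  fixes u :: "real \<Rightarrow> ennreal"
  assumes [measurable]: "u \<in> borel_measurable borel" and A: "0 < A"
  shows "(\<integral>\<^sup>+x. min (u x) (ennreal A) \<partial>lborel)
    = ennreal A * (\<integral>\<^sup>+s. indicator {0<..<1} s * emeasure lborel {x. ennreal (A * s) < u x} \<partial>lborel)"
proof -
  have "(\<integral>\<^sup>+x. min (u x) (ennreal A) \<partial>lborel)
      = (\<integral>\<^sup>+x. ennreal A * (\<integral>\<^sup>+s. indicator {s. 0 < s \<and> s < 1 \<and> ennreal (A * s) < u x} s \<partial>lborel) \<partial>lborel)"
    by (intro nn_integral_cong) (rule layer_integral_less[OF A, symmetric])
  also have "\<dots> = ennreal A * (\<integral>\<^sup>+x. (\<integral>\<^sup>+s. indicator {s. 0 < s \<and> s < 1 \<and> ennreal (A * s) < u x} s \<partial>lborel) \<partial>lborel)"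
    by (rule nn_integral_cmult) measurable
  also have "(\<integral>\<^sup>+x. (\<integral>\<^sup>+s. indicator {s. 0 < s \<and> s < 1 \<and> ennreal (A * s) < u x} s \<partial>lborel) \<partial>lborel)
      = (\<integral>\<^sup>+s. (\<integral>\<^sup>+x. indicator {s. 0 < s \<and> s < 1 \<and> ennreal (A * s) < u x} s \<partial>lborel) \<partial>lborel)"
    by (rule lborel_pair.Fubini') measurable
  also have "\<dots> = (\<integral>\<^sup>+s. (\<integral>\<^sup>+x. indicator {0<..<1} s * indicator {x. ennreal (A * s) < u x} x \<partial>lborel) \<partial>lborel)"
    by (intro nn_integral_cong) (auto simp: indicator_def)
  also have "\<dots> = (\<integral>\<^sup>+s. indicator {0<..<1} s * emeasure lborel {x. ennreal (A * s) < u x} \<partial>lborel)"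
    by (intro nn_integral_cong) (subst nn_integral_cmult, auto)
  finally show ?thesis .
qed

lemma layer_cake_le:
  fixes u :: "real \<Rightarrow> ennreal"
  assumes [measurable]: "u \<in> borel_measurable borel" and A: "0 < A"
  shows "ennreal A * (\<integral>\<^sup>+s. indicator {0<..<1} s * emeasure lborel {x. ennreal (A * s) \<le> u x} \<partial>lborel)
    \<le> (\<integral>\<^sup>+x. u x \<partial>lborel)"
proof -
  have "(\<integral>\<^sup>+s. indicator {0<..<1} s * emeasure lborel {x. ennreal (A * s) \<le> u x} \<partial>lborel)
     = (\<integral>\<^sup>+s. (\<integral>\<^sup>+x. indicator {0<..<1} s * indicator {x. ennreal (A * s) \<le> u x} x \<partial>lborel) \<partial>lborel)"
    by (intro nn_integral_cong) (subst nn_integral_cmult, auto)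
  also have "\<dots> = (\<integral>\<^sup>+s. (\<integral>\<^sup>+x. indicator {s. 0 < s \<and> s < 1 \<and> ennreal (A * s) \<le> u x} s \<partial>lborel) \<partial>lborel)"
    by (intro nn_integral_cong) (auto simp: indicator_def)
  also have "\<dots> = (\<integral>\<^sup>+x. (\<integral>\<^sup>+s. indicator {s. 0 < s \<and> s < 1 \<and> ennreal (A * s) \<le> u x} s \<partial>lborel) \<partial>lborel)"
    by (rule lborel_pair.Fubini') measurable
  finally have "ennreal A * (\<integral>\<^sup>+s. indicator {0<..<1} s * emeasure lborel {x. ennreal (A * s) \<le> u x} \<partial>lborel)
     = (\<integral>\<^sup>+x. ennreal A * (\<integral>\<^sup>+s. indicator {s. 0 < s \<and> s < 1 \<and> ennreal (A * s) \<le> u x} s \<partial>lborel) \<partial>lborel)"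
    by (subst nn_integral_cmult) auto
  also have "\<dots> \<le> (\<integral>\<^sup>+x. u x \<partial>lborel)"
    by (intro nn_integral_mono layer_integral_le A)
  finally show ?thesis .
qed

text \<open>
  Integrals over level sets only see \<open>u\<close> truncated at a finite height \<open>A\<close>. The height must not exceed the
  supremum of \<open>u\<close>, since otherwise some levels in the range \<open>(0, A)\<close> have an empty level set, to which the
  Brunn-Minkowski inequality does not apply.
\<close>

lemma nn_integral_truncation:
  fixes u :: "'a \<Rightarrow> ennreal"
  assumes [measurable]: "u \<in> borel_measurable M" and r: "ennreal r < (\<integral>\<^sup>+x. u x \<partial>M)" and "0 < r"
  obtains A where "0 < A" "ennreal A \<le> (SUP x. u x)" "ennreal r < (\<integral>\<^sup>+x. min (u x) (ennreal A) \<partial>M)"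
proof (cases "(SUP x. u x) = \<infinity>")
  case True
  have "(\<integral>\<^sup>+x. u x \<partial>M) = (\<integral>\<^sup>+x. (SUP n. min (u x) (ennreal (real n))) \<partial>M)"
  proof (intro nn_integral_cong)
    fix x
    have "(SUP n. min (u x) (ennreal (real n))) = min (u x) (SUP n. of_nat n)"
      by (simp add: inf_min[symmetric] inf_SUP ennreal_of_nat_eq_real_of_nat)
    then show "u x = (SUP n. min (u x) (ennreal (real n)))"
      by (simp add: ennreal_SUP_of_nat_eq_top)
  qed
  also have "\<dots> = (SUP n. \<integral>\<^sup>+x. min (u x) (ennreal (real n)) \<partial>M)"
    by (intro nn_integral_monotone_convergence_SUP)
       (auto simp: incseq_def le_fun_def min_le_iff_disj intro!: min.mono ennreal_leI)
  finally obtain n where n: "ennreal r < (\<integral>\<^sup>+x. min (u x) (ennreal (real n)) \<partial>M)"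
    using r by (auto simp: less_SUP_iff)
  then have "n \<noteq> 0" by (auto intro!: Nat.gr0I)
  then show ?thesis using that[of "real n"] n True by simp
next
  case False
  then obtain A where A: "(SUP x. u x) = ennreal A" "0 \<le> A"
    by (cases "SUP x. u x") auto
  have le: "u x \<le> ennreal A" for x unfolding A(1)[symmetric] by (rule SUP_upper) simp
  then have eq: "min (u x) (ennreal A) = u x" for x by (simp add: min_def)
  have "A \<noteq> 0"
  proof
    assume "A = 0"
    then have "u = (\<lambda>x. 0)" using le by auto
    then show False using r by simp
  qed
  then show ?thesis using that[of A] A r by (simp add: eq)
qed

text \<open>
  The levels are parametrised so that level \<open>A s\<close> of \<open>u\<close> and level \<open>B s\<close> of \<open>v\<close> correspond to level \<open>K s\<close> of
  \<open>h\<close> with \<open>K = A\<^bsup>1 - t\<^esup> B\<^bsup>t\<^esup>\<close>, for one common parameter \<open>s \<in> (0, 1)\<close>. The Brunn-Minkowski inequality at each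
  \<open>s\<close> then integrates to \<open>\<integral> h \<ge> K ((1 - t) \<integral> u / A + t \<integral> v / B)\<close>, and the weighted inequality of
  arithmetic and geometric means removes \<open>A\<close> and \<open>B\<close>.
\<close>

lemma prekopa_leindler_real:
  fixes u v h :: "real \<Rightarrow> ennreal"
  assumes [measurable]: "u \<in> borel_measurable borel" "v \<in> borel_measurable borel" "h \<in> borel_measurable borel"
    and t: "0 < t" "t < 1"
    and uvh: "\<And>x y. gmean_le t (u x) (v y) (h ((1 - t) * x + t * y))"
  shows "gmean_le t (\<integral>\<^sup>+x. u x \<partial>lborel) (\<integral>\<^sup>+x. v x \<partial>lborel) (\<integral>\<^sup>+x. h x \<partial>lborel)"
  unfolding gmean_le_def
proof (intro allI impI)
  fix p q :: real
  assume p: "0 < p" "ennreal p < (\<integral>\<^sup>+x. u x \<partial>lborel)" and q: "0 < q" "ennreal q < (\<integral>\<^sup>+x. v x \<partial>lborel)"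
  obtain A where A: "0 < A" "ennreal A \<le> (SUP x. u x)" "ennreal p < (\<integral>\<^sup>+x. min (u x) (ennreal A) \<partial>lborel)"
    by (rule nn_integral_truncation[OF _ p(2,1)]) auto
  obtain B where B: "0 < B" "ennreal B \<le> (SUP x. v x)" "ennreal q < (\<integral>\<^sup>+x. min (v x) (ennreal B) \<partial>lborel)"
    by (rule nn_integral_truncation[OF _ q(2,1)]) auto
  define K where "K = A powr (1 - t) * B powr t"
  have K: "0 < K" using A B by (simp add: K_def)
  define IU where "IU = (\<integral>\<^sup>+s. indicator {0<..<1} s * emeasure lborel {x. ennreal (A * s) < u x} \<partial>lborel)"
  define IV where "IV = (\<integral>\<^sup>+s. indicator {0<..<1} s * emeasure lborel {x. ennreal (B * s) < v x} \<partial>lborel)"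
  have level: "ennreal (1 - t) * emeasure lborel {x. ennreal (A * s) < u x}
      + ennreal t * emeasure lborel {x. ennreal (B * s) < v x} \<le> emeasure lborel {x. ennreal (K * s) \<le> h x}"
    if s: "0 < s" "s < 1" for s
  proof (rule brunn_minkowski_real_convex[OF _ _ _ _ _ t])
    have "ennreal (A * s) < ennreal A" using A s by (simp add: ennreal_less_iff)
    then have "ennreal (A * s) < (SUP x. u x)" using A(2) by (rule less_le_trans)
    then show "{x. ennreal (A * s) < u x} \<noteq> {}" by (auto simp: less_SUP_iff)
    have "ennreal (B * s) < ennreal B" using B s by (simp add: ennreal_less_iff)
    then have "ennreal (B * s) < (SUP x. v x)" using B(2) by (rule less_le_trans)
    then show "{x. ennreal (B * s) < v x} \<noteq> {}" by (auto simp: less_SUP_iff)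
    fix x y assume "x \<in> {x. ennreal (A * s) < u x}" "y \<in> {x. ennreal (B * s) < v x}"
    then have "ennreal ((A * s) powr (1 - t) * (B * s) powr t) \<le> h ((1 - t) * x + t * y)"
      using uvh[of x y] A(1) B(1) s unfolding gmean_le_def by auto
    moreover have "(A * s) powr (1 - t) * (B * s) powr t = K * s"
    proof -
      have "s powr (1 - t) * s powr t = s" using s by (simp add: powr_add[symmetric])
      then show ?thesis using A(1) B(1) s by (simp add: K_def powr_mult mult.assoc mult.left_commute)
    qed
    ultimately show "(1 - t) * x + t * y \<in> {x. ennreal (K * s) \<le> h x}" by simp
  qed auto
  have "ennreal (1 - t) * IU + ennreal t * IV
     = (\<integral>\<^sup>+s. ennreal (1 - t) * (indicator {0<..<1} s * emeasure lborel {x. ennreal (A * s) < u x})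
         + ennreal t * (indicator {0<..<1} s * emeasure lborel {x. ennreal (B * s) < v x}) \<partial>lborel)"
    unfolding IU_def IV_def by (simp add: nn_integral_add nn_integral_cmult)
  also have "\<dots> \<le> (\<integral>\<^sup>+s. indicator {0<..<1} s * emeasure lborel {x. ennreal (K * s) \<le> h x} \<partial>lborel)"
    by (intro nn_integral_mono) (auto simp: indicator_def level)
  finally have "ennreal K * (ennreal (1 - t) * IU + ennreal t * IV)
     \<le> ennreal K * (\<integral>\<^sup>+s. indicator {0<..<1} s * emeasure lborel {x. ennreal (K * s) \<le> h x} \<partial>lborel)"
    by (rule mult_left_mono) simp
  also have "\<dots> \<le> (\<integral>\<^sup>+x. h x \<partial>lborel)" by (rule layer_cake_le[OF _ K]) auto
  finally have H: "ennreal K * (ennreal (1 - t) * IU + ennreal t * IV) \<le> (\<integral>\<^sup>+x. h x \<partial>lborel)" .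
  have scale: "ennreal (r / D) \<le> I" if "ennreal r < ennreal D * I" "0 < D" "0 < r" for r D I
  proof (cases I)
    case (real i)
    then have "r < D * i" using that by (simp add: ennreal_mult[symmetric] ennreal_less_iff)
    then show ?thesis using real that by (simp add: field_simps)
  qed simp
  have "ennreal (p / A) \<le> IU"
    using A(3) unfolding layer_cake_less[OF assms(1) A(1)] IU_def[symmetric] by (intro scale A p)
  moreover have "ennreal (q / B) \<le> IV"
    using B(3) unfolding layer_cake_less[OF assms(2) B(1)] IV_def[symmetric] by (intro scale B q)
  ultimately have "ennreal K * (ennreal (1 - t) * ennreal (p / A) + ennreal t * ennreal (q / B))
      \<le> ennreal K * (ennreal (1 - t) * IU + ennreal t * IV)"
    by (intro mult_left_mono add_mono) auto
  also note H
  also have "ennreal K * (ennreal (1 - t) * ennreal (p / A) + ennreal t * ennreal (q / B))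
      = ennreal (K * ((1 - t) * (p / A) + t * (q / B)))"
    using t A B p q K by (simp add: ennreal_mult[symmetric] ennreal_plus[symmetric] del: ennreal_plus)
  finally have "ennreal (K * ((1 - t) * (p / A) + t * (q / B))) \<le> (\<integral>\<^sup>+x. h x \<partial>lborel)" .
  moreover have "p powr (1 - t) * q powr t \<le> K * ((1 - t) * (p / A) + t * (q / B))"
  proof -
    have "p powr (1 - t) * q powr t = K * ((p / A) powr (1 - t) * (q / B) powr t)"
      using A(1) B(1) p(1) q(1) by (simp add: K_def powr_divide)
    also have "\<dots> \<le> K * ((1 - t) * (p / A) + t * (q / B))"
      using A(1) B(1) p(1) q(1) t K by (intro mult_left_mono Youngs_inequality_0) auto
    finally show ?thesis .
  qed
  ultimately show "ennreal (p powr (1 - t) * q powr t) \<le> (\<integral>\<^sup>+x. h x \<partial>lborel)"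
    by (meson ennreal_leI order_trans)
qed

interpretation lborel_product: product_sigma_finite "\<lambda>i. lborel :: real measure"
  by standard

text \<open>
  The inequality is stable under products: for fixed values of the other coordinates, the
  one-dimensional case shows that the integrals over one coordinate again satisfy the hypothesis.
\<close>

lemma prekopa_leindler_PiM:
  fixes u v h :: "('i \<Rightarrow> real) \<Rightarrow> ennreal"
  assumes "finite I" and t: "0 < t" "t < 1"
    and "u \<in> borel_measurable (Pi\<^sub>M I (\<lambda>_. lborel))" "v \<in> borel_measurable (Pi\<^sub>M I (\<lambda>_. lborel))"
      "h \<in> borel_measurable (Pi\<^sub>M I (\<lambda>_. lborel))"
    and "\<And>x y. x \<in> space (Pi\<^sub>M I (\<lambda>_. lborel)) \<Longrightarrow> y \<in> space (Pi\<^sub>M I (\<lambda>_. lborel)) \<Longrightarrow>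
      gmean_le t (u x) (v y) (h (\<lambda>i\<in>I. (1 - t) * x i + t * y i))"
  shows "gmean_le t (integral\<^sup>N (Pi\<^sub>M I (\<lambda>_. lborel)) u) (integral\<^sup>N (Pi\<^sub>M I (\<lambda>_. lborel)) v)
    (integral\<^sup>N (Pi\<^sub>M I (\<lambda>_. lborel)) h)"
  using assms(1,4-7)
proof (induction I arbitrary: u v h rule: finite_induct)
  case empty
  then show ?case
    using empty.prems(4)[of "\<lambda>_. undefined" "\<lambda>_. undefined"]
    by (simp add: PiM_empty nn_integral_count_space_finite restrict_def)
next
  case (insert i I)
  note [measurable] = insert.prems(1-3)
  let ?P = "Pi\<^sub>M I (\<lambda>_. lborel :: real measure)"
  let ?Q = "Pi\<^sub>M (insert i I) (\<lambda>_. lborel :: real measure)"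
  have meas: "(\<lambda>y. w (x(i := y))) \<in> borel_measurable borel"
    if w: "w \<in> borel_measurable ?Q" and x: "x \<in> space ?P" for w :: "('i \<Rightarrow> real) \<Rightarrow> ennreal" and x
  proof -
    have "(\<lambda>y. x(i := y)) \<in> measurable lborel ?Q"
      using measurable_component_update[OF x insert.hyps(2)] by simp
    from measurable_compose[OF this w] show ?thesis by simp
  qed
  have meas2: "(\<lambda>x. \<integral>\<^sup>+y. w (x(i := y)) \<partial>lborel) \<in> borel_measurable ?P"
    if w: "w \<in> borel_measurable ?Q" for w :: "('i \<Rightarrow> real) \<Rightarrow> ennreal"
  proof -
    note [measurable] = w
    show ?thesis by measurable
  qed
  show ?case
    unfolding lborel_product.product_nn_integral_insert[OF insert.hyps insert.prems(1)]
      lborel_product.product_nn_integral_insert[OF insert.hyps insert.prems(2)]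
      lborel_product.product_nn_integral_insert[OF insert.hyps insert.prems(3)]
  proof (rule insert.IH)
    fix x y assume x: "x \<in> space ?P" and y: "y \<in> space ?P"
    let ?z = "\<lambda>i\<in>I. (1 - t) * x i + t * y i"
    have z: "?z \<in> space ?P" by (auto simp: space_PiM)
    show "gmean_le t (\<integral>\<^sup>+a. u (x(i := a)) \<partial>lborel) (\<integral>\<^sup>+a. v (y(i := a)) \<partial>lborel)
        (\<integral>\<^sup>+a. h (?z(i := a)) \<partial>lborel)"
    proof (rule prekopa_leindler_real[OF _ _ _ t])
      fix a b :: real
      have "x(i := a) \<in> space ?Q" "y(i := b) \<in> space ?Q"
        using x y by (auto simp: space_PiM PiE_def extensional_def)
      from insert.prems(4)[OF this]
      have "gmean_le t (u (x(i := a))) (v (y(i := b)))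
         (h (\<lambda>j\<in>insert i I. (1 - t) * (x(i := a)) j + t * (y(i := b)) j))" .
      also have "(\<lambda>j\<in>insert i I. (1 - t) * (x(i := a)) j + t * (y(i := b)) j)
          = ?z(i := (1 - t) * a + t * b)"
        using insert.hyps(2) by (auto simp: restrict_def)
      finally show "gmean_le t (u (x(i := a))) (v (y(i := b))) (h (?z(i := (1 - t) * a + t * b)))" .
    qed (rule meas[OF insert.prems(1) x], rule meas[OF insert.prems(2) y], rule meas[OF insert.prems(3) z])
  qed (rule meas2[OF insert.prems(1)], rule meas2[OF insert.prems(2)], rule meas2[OF insert.prems(3)])
qed

theorem prekopa_leindler:
  fixes u v h :: "'a::euclidean_space \<Rightarrow> ennreal"
  assumes [measurable]: "u \<in> borel_measurable borel" "v \<in> borel_measurable borel" "h \<in> borel_measurable borel"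
    and t: "0 < t" "t < 1"
    and uvh: "\<And>x y. gmean_le t (u x) (v y) (h ((1 - t) *\<^sub>R x + t *\<^sub>R y))"
  shows "gmean_le t (\<integral>\<^sup>+x. u x \<partial>lborel) (\<integral>\<^sup>+x. v x \<partial>lborel) (\<integral>\<^sup>+x. h x \<partial>lborel)"
proof -
  let ?T = "\<lambda>f. \<Sum>b\<in>Basis. f b *\<^sub>R b :: 'a"
  let ?P = "Pi\<^sub>M (Basis :: 'a set) (\<lambda>_. lborel :: real measure)"
  have T[measurable]: "?T \<in> measurable ?P borel" by measurable
  have int: "(\<integral>\<^sup>+x. w x \<partial>lborel) = (\<integral>\<^sup>+f. w (?T f) \<partial>?P)"
    if [measurable]: "w \<in> borel_measurable borel" for w :: "'a \<Rightarrow> ennreal"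
    by (subst lborel_eq) (simp add: nn_integral_distr)
  show ?thesis
    unfolding int[OF assms(1)] int[OF assms(2)] int[OF assms(3)]
  proof (rule prekopa_leindler_PiM[OF finite_Basis t])
    fix x y :: "'a \<Rightarrow> real"
    have "?T (\<lambda>i\<in>Basis. (1 - t) * x i + t * y i) = (1 - t) *\<^sub>R ?T x + t *\<^sub>R ?T y"
      by (simp add: scaleR_sum_right sum.distrib[symmetric] scaleR_add_left cong: sum.cong)
    then show "gmean_le t (u (?T x)) (v (?T y)) (h (?T (\<lambda>i\<in>Basis. (1 - t) * x i + t * y i)))"
      using uvh[of "?T x" "?T y"] by simp
  qed measurable
qed

lemma gmean_le_realI:
  assumes "a powr (1 - t) * b powr t \<le> c" "0 \<le> a" "0 \<le> b" "0 \<le> t" "t \<le> 1"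
  shows "gmean_le t (ennreal a) (ennreal b) (ennreal c)"
  unfolding gmean_le_def
proof (intro allI impI)
  fix r s :: real assume rs: "0 < r" "0 < s" "ennreal r < ennreal a" "ennreal s < ennreal b"
  then have "r \<le> a" "s \<le> b" by (auto simp: ennreal_less_iff)
  then have "r powr (1 - t) * s powr t \<le> a powr (1 - t) * b powr t"
    using rs assms by (intro mult_mono powr_mono2) auto
  then show "ennreal (r powr (1 - t) * s powr t) \<le> ennreal c"
    using assms(1) by (intro ennreal_leI) auto
qed

lemma gmean_le_realD:
  assumes g: "gmean_le t (ennreal a) (ennreal b) (ennreal c)" and nn: "0 \<le> a" "0 \<le> b" "0 \<le> c"
  shows "a powr (1 - t) * b powr t \<le> c"
proof (cases "a = 0 \<or> b = 0")
  case False
  then have ab: "0 < a" "0 < b" using nn by auto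
  show ?thesis
  proof (rule field_le_mult_one_interval)
    fix z :: real assume z: "0 < z" "z < 1"
    have "ennreal ((z * a) powr (1 - t) * (z * b) powr t) \<le> ennreal c"
      using g ab z unfolding gmean_le_def by (auto simp: ennreal_less_iff)
    then have "(z * a) powr (1 - t) * (z * b) powr t \<le> c" using nn by simp
    moreover have "(z * a) powr (1 - t) * (z * b) powr t = (z powr (1 - t) * z powr t) * (a powr (1 - t) * b powr t)"
      using z ab by (simp add: powr_mult)
    moreover have "z powr (1 - t) * z powr t = z" using z by (simp add: powr_add[symmetric])
    ultimately show "z * (a powr (1 - t) * b powr t) \<le> c" by simp
  qed
qed (use nn in auto)

section \<open>Log-concave densities: boundedness and integrability\<close>

lemma nn_integral_lborel_affine:
  fixes w :: "'a::euclidean_space \<Rightarrow> ennreal"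
  assumes [measurable]: "w \<in> borel_measurable borel" and c: "c \<noteq> 0"
  shows "(\<integral>\<^sup>+x. w (a + c *\<^sub>R x) \<partial>lborel) = ennreal (inverse \<bar>c\<bar> ^ DIM('a)) * (\<integral>\<^sup>+x. w x \<partial>lborel)"
proof -
  have "(\<integral>\<^sup>+x. w x \<partial>lborel) = (\<integral>\<^sup>+x. w x \<partial>density (distr lborel borel (\<lambda>x. a + c *\<^sub>R x)) (\<lambda>_. \<bar>c\<bar> ^ DIM('a)))"
    using lborel_affine[OF c, of a] by simp
  also have "\<dots> = ennreal (\<bar>c\<bar> ^ DIM('a)) * (\<integral>\<^sup>+x. w (a + c *\<^sub>R x) \<partial>lborel)"
    by (simp add: nn_integral_density nn_integral_distr nn_integral_cmult)
  finally have *: "(\<integral>\<^sup>+x. w x \<partial>lborel) = ennreal (\<bar>c\<bar> ^ DIM('a)) * (\<integral>\<^sup>+x. w (a + c *\<^sub>R x) \<partial>lborel)" .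
  have "ennreal (inverse \<bar>c\<bar> ^ DIM('a)) * ennreal (\<bar>c\<bar> ^ DIM('a)) = 1"
    using c by (simp add: ennreal_mult[symmetric] power_mult_distrib[symmetric])
  then show ?thesis unfolding * by (simp add: mult.assoc[symmetric])
qed

lemma powr_minus_one_mult: "x powr (a - 1) * x = x powr a" if "0 < x" for x a :: real
  using that by (simp add: powr_diff)

locale log_concave_density =
  fixes f :: "'a::euclidean_space \<Rightarrow> real"
  assumes nonneg: "\<And>x. 0 \<le> f x"
    and log_concave: "log_concave_fun f"
    and measurable[measurable]: "f \<in> borel_measurable borel"
    and total_mass: "(\<integral>\<^sup>+x. ennreal (f x) \<partial>lborel) = 1"
begin

lemma convex_combination:
  assumes "0 < t" "t < 1"
  shows "f x powr (1 - t) * f y powr t \<le> f ((1 - t) *\<^sub>R x + t *\<^sub>R y)"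
  using log_concave assms unfolding log_concave_fun_def by auto

lemma superlevel_positive_measure:
  obtains s where "0 < s" "0 < emeasure lborel {x. s < f x}"
proof -
  have "\<not> (AE x in lborel. f x \<le> 0)"
  proof
    assume "AE x in lborel. f x \<le> 0"
    then have "(\<integral>\<^sup>+x. ennreal (f x) \<partial>lborel) = 0"
      by (subst nn_integral_0_iff_AE) (auto simp: ennreal_eq_0_iff)
    then show False by (simp add: total_mass)
  qed
  moreover have "AE x in lborel. f x \<le> 0" if *: "\<And>s. 0 < s \<Longrightarrow> emeasure lborel {x. s < f x} = 0"
  proof -
    have "AE x in lborel. f x \<le> 1 / real (Suc n)" for n
      using *[of "1 / real (Suc n)"] by (intro AE_I'[of "{x. 1 / real (Suc n) < f x}"]) (auto simp: null_setsI)
    then have "AE x in lborel. \<forall>n. f x \<le> 1 / real (Suc n)" by (simp add: AE_all_countable)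
    then show ?thesis
    proof eventually_elim
      case (elim x)
      show ?case
      proof (rule ccontr)
        assume "\<not> f x \<le> 0"
        then obtain n where "1 / real (Suc n) < f x" using nat_approx_posE[of "f x"] by auto
        then show False using elim by (simp add: leD)
      qed
    qed
  qed
  ultimately show ?thesis using that by (metis not_gr_zero)
qed

text \<open>
  A log-concave density never exceeds its essential supremum, not even on a null set: if \<open>f\<close> is at least
  \<open>s > 0\<close> on a set of positive measure, then it is at least \<open>f x\<^sub>0\<^bsup>1 - t\<^esup> s\<^bsup>t\<^esup>\<close> on the image of this set under
  the contraction by \<open>t\<close> towards \<open>x\<^sub>0\<close>, and this bound tends to \<open>f x\<^sub>0\<close> as \<open>t\<close> tends to \<open>0\<close>.
\<close>

lemma le_AE_bound:
  assumes ae: "AE x in lborel. f x \<le> c"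
  shows "f x0 \<le> c"
proof (rule ccontr)
  assume "\<not> f x0 \<le> c"
  then have c: "c < f x0" by simp
  obtain s where s: "0 < s" "0 < emeasure lborel {x. s < f x}" by (rule superlevel_positive_measure)
  show False
  proof (cases "f x0 = 0")
    case True
    then have "AE x in lborel. f x < 0" using ae c by (auto elim: eventually_mono)
    then have "AE x in (lborel :: 'a measure). False" by (rule eventually_mono) (metis nonneg not_less)
    then have "emeasure lborel (UNIV :: 'a set) = 0" by (subst (asm) AE_iff_measurable[OF _ refl]) auto
    then show False by simp
  next
    case False
    then have f0: "0 < f x0" using nonneg[of x0] by simp
    have "((\<lambda>t. f x0 powr (1 - t) * s powr t) \<longlongrightarrow> f x0 powr (1 - 0) * s powr 0) (at_right 0)"
      using f0 s by (intro tendsto_intros) auto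
    then have "((\<lambda>t. f x0 powr (1 - t) * s powr t) \<longlongrightarrow> f x0) (at_right 0)"
      using f0 s by simp
    then have "\<forall>\<^sub>F t in at_right 0. c < f x0 powr (1 - t) * s powr t"
      using c by (simp add: order_tendsto_iff)
    moreover have "\<forall>\<^sub>F t in at_right (0::real). 0 < t \<and> t < 1"
      by (intro eventually_conj eventually_at_right_less eventually_at_right_real[of 0 1, simplified, THEN eventually_mono]) auto
    ultimately have "\<forall>\<^sub>F t in at_right 0. c < f x0 powr (1 - t) * s powr t \<and> 0 < t \<and> t < 1"
      by eventually_elim auto
    then obtain t where t: "c < f x0 powr (1 - t) * s powr t" "0 < t" "t < 1"
      using eventually_happens'[OF trivial_limit_at_right_real] by blast
    \<comment> \<open>the expansion \<open>x \<mapsto> - ((1 - t) / t) x\<^sub>0 + x / t\<close> inverts the contraction by \<open>t\<close> towards \<open>x\<^sub>0\<close>\<close>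
    have "0 < ennreal (inverse \<bar>inverse t\<bar> ^ DIM('a)) * emeasure lborel {x. s < f x}"
      using s t by (simp add: ennreal_zero_less_mult_iff)
    also have "\<dots> = ennreal (inverse \<bar>inverse t\<bar> ^ DIM('a)) * (\<integral>\<^sup>+x. indicator {x. s < f x} x \<partial>lborel)"
      by simp
    also have "\<dots> = (\<integral>\<^sup>+x. indicator {x. s < f x} (- (((1 - t) / t) *\<^sub>R x0) + inverse t *\<^sub>R x) \<partial>lborel)"
      using t by (subst nn_integral_lborel_affine) auto
    also have "\<dots> \<le> (\<integral>\<^sup>+x. indicator {x. c < f x} x \<partial>lborel)"
    proof (intro nn_integral_mono)
      fix z :: 'a
      let ?y = "- (((1 - t) / t) *\<^sub>R x0) + inverse t *\<^sub>R z"
      have z: "(1 - t) *\<^sub>R x0 + t *\<^sub>R ?y = z"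
        using t by (simp add: scaleR_add_right scaleR_right_diff_distrib)
      have "c < f z" if "s < f ?y"
      proof -
        have "f x0 powr (1 - t) * s powr t \<le> f x0 powr (1 - t) * f ?y powr t"
          using that s t by (intro mult_left_mono powr_mono2) auto
        also have "\<dots> \<le> f z" using convex_combination[OF t(2,3), of x0 ?y] z by simp
        finally show ?thesis using t(1) by simp
      qed
      then show "indicator {x. s < f x} ?y \<le> (indicator {x. c < f x} z :: ennreal)"
        by (auto simp: indicator_def)
    qed
    also have "\<dots> = emeasure lborel {x. c < f x}" by simp
    also have "\<dots> = 0"
      using ae by (subst (asm) AE_iff_measurable[OF _ refl]) (auto simp: not_le)
    finally show False by simp
  qed
qed

text \<open>
  On the midpoints of \<open>x\<^sub>0\<close> with a set of positive measure on which \<open>f > s\<close>, the density is at least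
  \<open>sqrt (s f x\<^sub>0)\<close>. As the total mass is one, \<open>f x\<^sub>0\<close> cannot be arbitrarily large.
\<close>

lemma bounded: obtains B where "0 < B" "\<And>x. f x \<le> B"
proof -
  obtain s where s: "0 < s" "0 < emeasure lborel {x. s < f x}" by (rule superlevel_positive_measure)
  obtain m where m: "0 < m" "ennreal m < emeasure lborel {x. s < f x}"
  proof -
    obtain m where "0 < m" "m < emeasure lborel {x. s < f x}" using dense[OF s(2)] by blast
    then show thesis using that[of "enn2real m"] by (cases m) auto
  qed
  have "f x0 \<le> (2 ^ DIM('a) / m)\<^sup>2 / s" for x0
  proof -
    let ?q = "f x0 powr (1 - 1/2) * s powr (1/2)"
    have "ennreal ?q * ennreal m \<le> ennreal ?q * emeasure lborel {x. s < f x}"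
      using m by (intro mult_left_mono) auto
    also have "\<dots> = (\<integral>\<^sup>+x. ennreal ?q * indicator {x. s < f x} x \<partial>lborel)"
      by (subst nn_integral_cmult) auto
    also have "\<dots> \<le> (\<integral>\<^sup>+x. ennreal (f ((1/2) *\<^sub>R x0 + (1/2) *\<^sub>R x)) \<partial>lborel)"
    proof (intro nn_integral_mono)
      fix x
      have "ennreal ?q \<le> ennreal (f ((1/2) *\<^sub>R x0 + (1/2) *\<^sub>R x))" if "s < f x"
      proof (intro ennreal_leI)
        have "?q \<le> f x0 powr (1 - 1/2) * f x powr (1/2)"
          using that s by (intro mult_left_mono powr_mono2) auto
        also have "\<dots> \<le> f ((1/2) *\<^sub>R x0 + (1/2) *\<^sub>R x)" using convex_combination[of "1/2" x0 x] by simp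
        finally show "?q \<le> f ((1/2) *\<^sub>R x0 + (1/2) *\<^sub>R x)" .
      qed
      then show "ennreal ?q * indicator {x. s < f x} x \<le> ennreal (f ((1/2) *\<^sub>R x0 + (1/2) *\<^sub>R x))"
        by (auto simp: indicator_def)
    qed
    also have "\<dots> = ennreal (2 ^ DIM('a))"
      by (subst nn_integral_lborel_affine) (auto simp: total_mass)
    finally have "?q * m \<le> 2 ^ DIM('a)" using m by (simp add: ennreal_mult[symmetric])
    then have "?q \<le> 2 ^ DIM('a) / m" using m by (simp add: pos_le_divide_eq)
    moreover have q: "?q = sqrt (f x0 * s)"
      using s nonneg[of x0] by (simp add: powr_half_sqrt real_sqrt_mult)
    ultimately have "(sqrt (f x0 * s))\<^sup>2 \<le> (2 ^ DIM('a) / m)\<^sup>2"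
      using s nonneg[of x0] unfolding q by (intro power_mono) auto
    then have "f x0 * s \<le> (2 ^ DIM('a) / m)\<^sup>2" using s nonneg[of x0] by simp
    then show ?thesis using s by (simp add: pos_le_divide_eq)
  qed
  moreover have "0 < (2 ^ DIM('a) / m)\<^sup>2 / s" using s m by simp
  ultimately show ?thesis using that by blast
qed

text \<open>
  Integrate \<open>f x\<^bsup>a\<^esup> \<le> f x\<^sub>0\<^bsup>a - 1\<^esup> f ((1 - a) x\<^sub>0 + a x)\<close>; the dilation by \<open>a\<close> produces the dimensional factor.
  The bound also shows that \<open>f\<^bsup>a\<^esup>\<close> is integrable for \<open>a < 1\<close>.
\<close>

lemma nn_integral_powr_less_one:
  assumes a: "0 < a" "a < 1" and x0: "0 < f x0"
  shows "(\<integral>\<^sup>+x. ennreal (f x powr a) \<partial>lborel) \<le> ennreal (inverse a ^ DIM('a) * f x0 powr (a - 1))"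
proof -
  have "(\<integral>\<^sup>+x. ennreal (f x powr a) \<partial>lborel)
     \<le> (\<integral>\<^sup>+x. ennreal (f x0 powr (a - 1)) * ennreal (f ((1 - a) *\<^sub>R x0 + a *\<^sub>R x)) \<partial>lborel)"
  proof (intro nn_integral_mono)
    fix x
    have "f x powr a = f x0 powr (a - 1) * (f x0 powr (1 - a) * f x powr a)"
      using x0 by (simp add: powr_add[symmetric] mult.assoc[symmetric])
    also have "\<dots> \<le> f x0 powr (a - 1) * f ((1 - a) *\<^sub>R x0 + a *\<^sub>R x)"
      using convex_combination[OF a] by (intro mult_left_mono) auto
    finally show "ennreal (f x powr a) \<le> ennreal (f x0 powr (a - 1)) * ennreal (f ((1 - a) *\<^sub>R x0 + a *\<^sub>R x))"
      using nonneg by (simp add: ennreal_mult[symmetric])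
  qed
  also have "\<dots> = ennreal (f x0 powr (a - 1)) * (\<integral>\<^sup>+x. ennreal (f ((1 - a) *\<^sub>R x0 + a *\<^sub>R x)) \<partial>lborel)"
    by (subst nn_integral_cmult) auto
  also have "\<dots> = ennreal (inverse a ^ DIM('a) * f x0 powr (a - 1))"
    using a by (subst nn_integral_lborel_affine) (auto simp: total_mass ennreal_mult[symmetric] mult.commute)
  finally show ?thesis .
qed

lemma exists_positive: obtains x where "0 < f x"
proof -
  obtain s where s: "0 < s" "0 < emeasure lborel {x. s < f x}" by (rule superlevel_positive_measure)
  then have "{x. s < f x} \<noteq> {}" by force
  then obtain x where "s < f x" by blast
  then have "0 < f x" using s by linarith
  then show ?thesis by (rule that)
qed

lemma integrable: "integrable lborel f"
  by (rule integrableI_nonneg) (auto simp: nonneg total_mass)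

lemma integral_one: "(LINT x|lborel. f x) = 1"
  using nn_integral_eq_integral[OF integrable] total_mass nonneg integral_nonneg_AE[of f lborel]
  by (simp add: ennreal_eq_1)

lemma integrable_powr:
  assumes "0 < a"
  shows "integrable lborel (\<lambda>x. f x powr a)"
proof -
  consider "a < 1" | "1 \<le> a" by linarith
  then show ?thesis
  proof cases
    case 1
    obtain x0 where x0: "0 < f x0" by (rule exists_positive)
    have "(\<integral>\<^sup>+x. ennreal (f x powr a) \<partial>lborel) < \<infinity>"
      using nn_integral_powr_less_one[OF assms 1 x0] by (rule le_less_trans) simp
    then show ?thesis by (intro integrableI_nonneg) auto
  next
    case 2
    obtain B where B: "0 < B" "\<And>x. f x \<le> B" using bounded by blast
    show ?thesis
    proof (rule Bochner_Integration.integrable_bound)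
      show "integrable lborel (\<lambda>x. B powr (a - 1) * f x)" by (intro integrable_mult_right integrable)
      have "f x powr a \<le> B powr (a - 1) * f x" for x
      proof (cases "f x = 0")
        case False
        then have p: "0 < f x" using nonneg[of x] by simp
        have "f x powr a = f x powr (a - 1) * f x"
          by (simp add: powr_minus_one_mult[OF p])
        also have "\<dots> \<le> B powr (a - 1) * f x" using 2 p B by (intro mult_right_mono powr_mono2) auto
        finally show ?thesis .
      qed simp
      then show "AE x in lborel. norm (f x powr a) \<le> norm (B powr (a - 1) * f x)"
        using nonneg by (auto simp: abs_mult)
    qed measurable
  qed
qed

lemma nn_integral_powr:
  assumes "0 < a"
  shows "(\<integral>\<^sup>+x. ennreal (f x powr a) \<partial>lborel) = ennreal (LINT x|lborel. f x powr a)"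
  using integrable_powr[OF assms] by (intro nn_integral_eq_integral) auto

lemma integral_powr_pos:
  assumes "0 < a"
  shows "0 < (LINT x|lborel. f x powr a)"
proof -
  have "(LINT x|lborel. f x powr a) \<noteq> 0"
  proof
    assume "(LINT x|lborel. f x powr a) = 0"
    then have "AE x in lborel. f x powr a = 0"
      using integrable_powr[OF assms] by (subst (asm) integral_nonneg_eq_0_iff_AE) auto
    then have "AE x in lborel. f x \<le> 0" by eventually_elim (simp add: powr_eq_0_iff)
    then have "\<And>x. f x \<le> 0" by (rule le_AE_bound)
    then show False using exists_positive by (metis leD)
  qed
  then show ?thesis by (simp add: less_le)
qed

section \<open>Comparison of the powers of a log-concave density\<close>

lemma integral_powr_upper:
  assumes "0 < a" "a < 1" "0 < f x0"
  shows "(LINT x|lborel. f x powr a) \<le> inverse a ^ DIM('a) * f x0 powr (a - 1)"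
  using nn_integral_powr_less_one[OF assms] assms by (subst (asm) nn_integral_powr) auto

text \<open>
  The counterpart for \<open>a > 1\<close>, from \<open>f x\<^sub>0\<^bsup>a - 1\<^esup> f x \<le> f ((1 - 1/a) x\<^sub>0 + x / a)\<^bsup>a\<^esup>\<close>.
\<close>

lemma integral_powr_lower:
  assumes a: "1 < a" and x0: "0 < f x0"
  shows "inverse a ^ DIM('a) * f x0 powr (a - 1) \<le> (LINT x|lborel. f x powr a)"
proof -
  let ?t = "inverse a"
  have t: "0 < ?t" "?t < 1" using a by (auto simp: field_simps)
  have "ennreal (f x0 powr (a - 1)) = ennreal (f x0 powr (a - 1)) * (\<integral>\<^sup>+x. ennreal (f x) \<partial>lborel)"
    by (simp add: total_mass)
  also have "\<dots> = (\<integral>\<^sup>+x. ennreal (f x0 powr (a - 1) * f x) \<partial>lborel)"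
    by (subst nn_integral_cmult[symmetric]) (auto simp: ennreal_mult nonneg)
  also have "\<dots> \<le> (\<integral>\<^sup>+x. ennreal (f ((1 - ?t) *\<^sub>R x0 + ?t *\<^sub>R x) powr a) \<partial>lborel)"
  proof (intro nn_integral_mono ennreal_leI)
    fix x
    have "f x0 powr (a - 1) * f x = (f x0 powr (1 - ?t) * f x powr ?t) powr a"
    proof -
      have "(1 - ?t) * a = a - 1" "?t * a = 1" using a by (auto simp: field_simps)
      then show ?thesis using nonneg[of x] unfolding powr_mult powr_powr by simp
    qed
    also have "\<dots> \<le> f ((1 - ?t) *\<^sub>R x0 + ?t *\<^sub>R x) powr a"
      using a convex_combination[OF t] by (intro powr_mono2) auto
    finally show "f x0 powr (a - 1) * f x \<le> f ((1 - ?t) *\<^sub>R x0 + ?t *\<^sub>R x) powr a" .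
  qed
  also have "\<dots> = ennreal (a ^ DIM('a) * (LINT x|lborel. f x powr a))"
    using a by (subst nn_integral_lborel_affine[where w="\<lambda>x. ennreal (f x powr a)"])
      (auto simp: nn_integral_powr ennreal_mult)
  finally have "f x0 powr (a - 1) \<le> a ^ DIM('a) * (LINT x|lborel. f x powr a)"
    using a integral_powr_pos[of a] by (subst (asm) ennreal_le_iff) auto
  then show ?thesis using a by (simp add: power_inverse field_simps)
qed

text \<open>
  This and the next lemma express that the entropy of order two is at most that of order \<open>a \<le> 2\<close>. It is
  Jensen's inequality for \<open>y \<mapsto> y\<^bsup>a - 1\<^esup>\<close> under the probability measure with density \<open>f\<close>, in the form of the
  tangent line at the mean value \<open>c\<close> of \<open>f\<close>.
\<close>

lemma integral_powr_collision_lower: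
  assumes "0 < a" "a < 1"
  defines "c \<equiv> LINT x|lborel. f x powr 2"
  shows "c powr (a - 1) \<le> (LINT x|lborel. f x powr a)"
proof -
  have c: "0 < c" unfolding c_def by (rule integral_powr_pos) simp
  have pt: "c powr (a - 1) * ((2 - a) * f x + (a - 1) / c * f x powr 2) \<le> f x powr a" for x
  proof (cases "f x = 0")
    case False
    then have p: "0 < f x" using nonneg[of x] by simp
    define y where "y = f x / c"
    have y: "0 < y" using p c by (simp add: y_def)
    have "1 + (a - 1) * (y - 1) \<le> 1 + (a - 1) * ln y"
      using ln_le_minus_one[OF y] assms by (simp add: mult_le_cancel_left)
    also have "\<dots> \<le> exp ((a - 1) * ln y)" by (rule exp_ge_add_one_self)
    also have "\<dots> = y powr (a - 1)" using y by (simp add: powr_def)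
    finally have "c powr (a - 1) * f x * (1 + (a - 1) * (y - 1)) \<le> c powr (a - 1) * f x * y powr (a - 1)"
      using p by (intro mult_left_mono) auto
    also have "c powr (a - 1) * f x * y powr (a - 1) = f x powr (a - 1) * f x"
      using p c by (simp add: y_def powr_divide)
    also have "\<dots> = f x powr a" by (simp add: powr_minus_one_mult[OF p])
    also have "c powr (a - 1) * f x * (1 + (a - 1) * (y - 1)) = c powr (a - 1) * ((2 - a) * f x + (a - 1) / c * f x powr 2)"
      using p c by (simp add: y_def power2_eq_square field_simps)
    finally show ?thesis .
  qed simp
  have "c powr (a - 1) = c powr (a - 1) * ((2 - a) * 1 + (a - 1) / c * c)" using c by simp
  also have "\<dots> = (LINT x|lborel. c powr (a - 1) * ((2 - a) * f x + (a - 1) / c * f x powr 2))"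
    using integrable integrable_powr[of 2] by (simp add: integral_one c_def)
  also have "\<dots> \<le> (LINT x|lborel. f x powr a)"
    using integrable integrable_powr[of 2] integrable_powr[OF assms(1)] pt by (intro integral_mono) auto
  finally show ?thesis .
qed

lemma integral_powr_collision_upper:
  assumes "1 < a" "a \<le> 2"
  defines "c \<equiv> LINT x|lborel. f x powr 2"
  shows "(LINT x|lborel. f x powr a) \<le> c powr (a - 1)"
proof -
  have c: "0 < c" unfolding c_def by (rule integral_powr_pos) simp
  have pt: "f x powr a \<le> c powr (a - 1) * ((2 - a) * f x + (a - 1) / c * f x powr 2)" for x
  proof (cases "f x = 0")
    case False
    then have p: "0 < f x" using nonneg[of x] by simp
    define y where "y = f x / c"
    have y: "0 < y" using p c by (simp add: y_def)
    have "y powr (a - 1) * 1 powr (2 - a) \<le> (a - 1) * y + (2 - a) * 1"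
      using assms y by (intro Youngs_inequality_0) auto
    then have "c powr (a - 1) * f x * y powr (a - 1) \<le> c powr (a - 1) * f x * (1 + (a - 1) * (y - 1))"
      using p by (intro mult_left_mono) (auto simp: algebra_simps)
    moreover have "c powr (a - 1) * f x * y powr (a - 1) = f x powr (a - 1) * f x"
      using p c by (simp add: y_def powr_divide)
    moreover have "\<dots> = f x powr a" by (simp add: powr_minus_one_mult[OF p])
    moreover have "c powr (a - 1) * f x * (1 + (a - 1) * (y - 1)) = c powr (a - 1) * ((2 - a) * f x + (a - 1) / c * f x powr 2)"
      using p c by (simp add: y_def power2_eq_square field_simps)
    ultimately show ?thesis by simp
  qed simp
  have "(LINT x|lborel. f x powr a) \<le> (LINT x|lborel. c powr (a - 1) * ((2 - a) * f x + (a - 1) / c * f x powr 2))"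
    using integrable integrable_powr[of 2] integrable_powr[of a] assms pt by (intro integral_mono) auto
  also have "\<dots> = c powr (a - 1) * ((2 - a) * 1 + (a - 1) / c * c)"
    using integrable integrable_powr[of 2] by (simp add: integral_one c_def)
  also have "\<dots> = c powr (a - 1)" using c by simp
  finally show ?thesis .
qed

lemma integrable_entropy: "integrable lborel (\<lambda>x. f x * ln (f x))"
proof -
  obtain B where B: "0 < B" "\<And>x. f x \<le> B" using bounded by blast
  show ?thesis
  proof (rule Bochner_Integration.integrable_bound)
    show "integrable lborel (\<lambda>x. \<bar>ln B\<bar> * f x + 2 * f x powr (1/2))"
      using integrable integrable_powr[of "1/2"] by auto
    have "\<bar>f x * ln (f x)\<bar> \<le> \<bar>ln B\<bar> * f x + 2 * f x powr (1/2)" for x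
    proof (cases "f x = 0")
      case False
      then have p: "0 < f x" using nonneg[of x] by simp
      have "ln (f x) \<le> \<bar>ln B\<bar>" using B(1) B(2)[of x] p by (smt (verit) ln_mono)
      then have 1: "f x * ln (f x) \<le> \<bar>ln B\<bar> * f x" using p by (simp add: mult.commute)
      \<comment> \<open>the tail of \<open>- f ln f\<close> is controlled by \<open>2 sqrt f\<close>, which is integrable\<close>
      have "- (1/2) * ln (f x) = ln (f x powr (- (1/2)))" using p by (simp add: ln_powr)
      also have "\<dots> \<le> f x powr (- (1/2)) - 1" using p by (intro ln_le_minus_one) simp
      finally have "- ln (f x) \<le> 2 * f x powr (- (1/2))" by simp
      then have "f x * (- ln (f x)) \<le> f x * (2 * f x powr (- (1/2)))" using p by (intro mult_left_mono) auto
      also have "\<dots> = 2 * (f x powr 1 * f x powr (- (1/2)))" using p by simp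
      also have "\<dots> = 2 * f x powr (1/2)" by (subst powr_add[symmetric]) simp
      finally have 2: "- (f x * ln (f x)) \<le> 2 * f x powr (1/2)" by simp
      have "0 \<le> \<bar>ln B\<bar> * f x" "0 \<le> 2 * f x powr (1/2)" using p by auto
      then show ?thesis using 1 2 by linarith
    qed simp
    then show "AE x in lborel. norm (f x * ln (f x)) \<le> norm (\<bar>ln B\<bar> * f x + 2 * f x powr (1/2))"
      by (intro AE_I2) (smt (verit, best) real_norm_def)
  qed measurable
qed

text \<open>
  The tangent line of the logarithm at \<open>c\<close> gives the case of order one.
\<close>

lemma entropy_collision_lower:
  "- ln (LINT x|lborel. f x powr 2) \<le> - (LINT x|lborel. f x * ln (f x))"
proof -
  define c where "c = (LINT x|lborel. f x powr 2)"
  have c: "0 < c" unfolding c_def by (rule integral_powr_pos) simp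
  have pt: "f x * ln (f x) \<le> (ln c - 1) * f x + f x powr 2 / c" for x
  proof (cases "f x = 0")
    case False
    then have p: "0 < f x" using nonneg[of x] by simp
    have "ln (f x) - ln c \<le> f x / c - 1" using ln_le_minus_one[of "f x / c"] p c by (simp add: ln_div)
    then have "f x * ln (f x) \<le> f x * (ln c - 1 + f x / c)" using p by (intro mult_left_mono) auto
    also have "\<dots> = (ln c - 1) * f x + f x powr 2 / c" using p by (simp add: algebra_simps power2_eq_square)
    finally show ?thesis .
  qed simp
  have "(LINT x|lborel. f x * ln (f x)) \<le> (LINT x|lborel. (ln c - 1) * f x + f x powr 2 / c)"
    using integrable integrable_powr[of 2] integrable_entropy pt by (intro integral_mono) auto
  also have "\<dots> = (ln c - 1) * 1 + c / c"
    using integrable integrable_powr[of 2] by (simp add: integral_one c_def)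
  also have "\<dots> = ln c" using c by simp
  finally show ?thesis by (simp add: c_def)
qed

text \<open>
  The Shannon entropy is bounded by the entropy of every order \<open>a < 1\<close>, and \<open>integral_powr_upper\<close> bounds the
  latter. Letting \<open>a\<close> tend to one turns the constant \<open>ln a / (a - 1) \<le> 1/a\<close> into \<open>1\<close>.
\<close>

lemma entropy_upper:
  assumes x0: "0 < f x0"
  shows "- (LINT x|lborel. f x * ln (f x)) \<le> - ln (f x0) + DIM('a)"
proof -
  let ?h = "- (LINT x|lborel. f x * ln (f x))"
  have step: "?h \<le> - ln (f x0) + DIM('a) / a" if a: "0 < a" "a < 1" for a
  proof -
    \<comment> \<open>tangent line of the logarithm at \<open>K\<close>, the bound for the mean of \<open>f\<^bsup>a - 1\<^esup>\<close>\<close>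
    define K where "K = inverse a ^ DIM('a) * f x0 powr (a - 1)"
    have K: "0 < K" using a x0 by (simp add: K_def)
    have pt: "(1 - a) * - (f x * ln (f x)) \<le> f x powr a / K + (ln K - 1) * f x" for x
    proof (cases "f x = 0")
      case False
      then have p: "0 < f x" using nonneg[of x] by simp
      have "(a - 1) * ln (f x) - ln K = ln (f x powr (a - 1) / K)" using p K by (simp add: ln_div ln_powr)
      also have "\<dots> \<le> f x powr (a - 1) / K - 1" using p K by (intro ln_le_minus_one) simp
      finally have "(a - 1) * ln (f x) \<le> f x powr (a - 1) / K + (ln K - 1)" by simp
      then have "f x * ((a - 1) * ln (f x)) \<le> f x * (f x powr (a - 1) / K + (ln K - 1))"
        using p by (intro mult_left_mono) auto
      also have "\<dots> = f x powr (a - 1) * f x / K + (ln K - 1) * f x" by (simp add: algebra_simps)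
      also have "f x powr (a - 1) * f x = f x powr a" by (simp add: powr_minus_one_mult[OF p])
      finally show ?thesis by (simp add: algebra_simps)
    qed simp
    have "(1 - a) * ?h = (LINT x|lborel. (1 - a) * - (f x * ln (f x)))" by simp
    also have "\<dots> \<le> (LINT x|lborel. f x powr a / K + (ln K - 1) * f x)"
      using integrable integrable_powr[OF a(1)] integrable_entropy pt by (intro integral_mono) auto
    also have "\<dots> = (LINT x|lborel. f x powr a) / K + (ln K - 1)"
      using integrable integrable_powr[OF a(1)] by (simp add: integral_one)
    also have "\<dots> \<le> ln K" using integral_powr_upper[OF a x0] K by (simp add: K_def[symmetric])
    also have "ln K = DIM('a) * (- ln a) + (a - 1) * ln (f x0)"
      using a x0 by (simp add: K_def ln_mult ln_powr ln_realpow ln_inverse)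
    also have "\<dots> \<le> DIM('a) * (inverse a - 1) + (a - 1) * ln (f x0)"
      using ln_le_minus_one[of "inverse a"] a by (intro add_right_mono mult_left_mono) (auto simp: ln_inverse)
    also have "\<dots> = (1 - a) * (- ln (f x0) + DIM('a) / a)" using a by (simp add: field_simps)
    finally have "(1 - a) * ?h \<le> (1 - a) * (- ln (f x0) + DIM('a) / a)" .
    then show ?thesis by (rule mult_left_le_imp_le) (use a in simp)
  qed
  have "((\<lambda>a. - ln (f x0) + DIM('a) / a) \<longlongrightarrow> - ln (f x0) + DIM('a) / 1) (at_left 1)"
    by (intro tendsto_intros) auto
  moreover have "\<forall>\<^sub>F a in at_left (1::real). ?h \<le> - ln (f x0) + DIM('a) / a"
    by (rule eventually_mono[OF eventually_at_left_real[of 0 1]]) (simp, rule step, auto)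
  ultimately have "?h \<le> - ln (f x0) + DIM('a) / 1"
    by (rule tendsto_lowerbound) simp
  then show ?thesis by simp
qed

text \<open>
  Log-concavity of \<open>p \<mapsto> p\<^sup>d \<integral> f\<^sup>p\<close> at the points \<open>1, 2, a\<close>. Writing \<open>2 = (1 - l) \<cdot> 1 + l a\<close> with
  \<open>l = 1 / (a - 1)\<close>, it is the Prekopa-Leindler inequality for \<open>f x\<close>, \<open>f (x / a)\<^bsup>a\<^esup>\<close> and \<open>f (x / 2)\<^bsup>2\<^esup>\<close>, whose
  hypothesis is log-concavity of \<open>f\<close> between \<open>x\<close> and \<open>y / a\<close>.
\<close>

lemma integral_powr_interpolation:
  assumes a: "2 < a"
  shows "a ^ DIM('a) * (LINT x|lborel. f x powr a)
    \<le> (2 ^ DIM('a) * (LINT x|lborel. f x powr 2)) powr (a - 1)"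
proof -
  define l where "l = 1 / (a - 1)"
  have l: "0 < l" "l < 1" and la: "l * a = 1 + l" using a by (auto simp: l_def field_simps)
  have "gmean_le l (\<integral>\<^sup>+x. ennreal (f x) \<partial>lborel)
     (\<integral>\<^sup>+x. ennreal (f (0 + inverse a *\<^sub>R x) powr a) \<partial>lborel)
     (\<integral>\<^sup>+x. ennreal (f (0 + inverse 2 *\<^sub>R x) powr 2) \<partial>lborel)"
  proof (rule prekopa_leindler[OF _ _ _ l])
    fix x y :: 'a
    show "gmean_le l (ennreal (f x)) (ennreal (f (0 + inverse a *\<^sub>R y) powr a))
      (ennreal (f (0 + inverse 2 *\<^sub>R ((1 - l) *\<^sub>R x + l *\<^sub>R y)) powr 2))"
    proof (rule gmean_le_realI)
      \<comment> \<open>\<open>((1 - l) x + l y) / 2\<close> is the point at weight \<open>(1 + l) / 2\<close> between \<open>x\<close> and \<open>y / a\<close>, as \<open>l a = 1 + l\<close>\<close>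
      let ?t = "(1 + l) / 2"
      have z: "(1 - ?t) *\<^sub>R x + ?t *\<^sub>R (inverse a *\<^sub>R y) = 0 + inverse 2 *\<^sub>R ((1 - l) *\<^sub>R x + l *\<^sub>R y)"
      proof -
        have "?t * inverse a = l / 2" using a unfolding la[symmetric] by simp
        moreover have "1 - ?t = (1 - l) / 2" by (simp add: field_simps)
        ultimately show ?thesis by (simp add: scaleR_add_right)
      qed
      have "f x powr (1 - l) * (f (inverse a *\<^sub>R y) powr a) powr l
        = (f x powr (1 - ?t) * f (inverse a *\<^sub>R y) powr ?t) powr 2"
      proof -
        have "(1 - ?t) * 2 = 1 - l" "?t * 2 = a * l" using la by (auto simp: field_simps)
        then show ?thesis by (simp only: powr_mult powr_powr)
      qed
      also have "\<dots> \<le> f ((1 - ?t) *\<^sub>R x + ?t *\<^sub>R (inverse a *\<^sub>R y)) powr 2"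
        using convex_combination[of ?t x "inverse a *\<^sub>R y"] l by (intro powr_mono2) auto
      finally show "f x powr (1 - l) * (f (0 + inverse a *\<^sub>R y) powr a) powr l
        \<le> f (0 + inverse 2 *\<^sub>R ((1 - l) *\<^sub>R x + l *\<^sub>R y)) powr 2" unfolding z by simp
    qed (use nonneg l in auto)
  qed measurable
  then have "gmean_le l (ennreal 1) (ennreal (a ^ DIM('a) * (LINT x|lborel. f x powr a)))
     (ennreal (2 ^ DIM('a) * (LINT x|lborel. f x powr 2)))"
    using a
    by (subst (asm) nn_integral_lborel_affine[where w="\<lambda>x. ennreal (f x powr a)"], simp, simp)
       (subst (asm) nn_integral_lborel_affine[where w="\<lambda>x. ennreal (f x powr 2)"],
        auto simp: nn_integral_powr total_mass ennreal_mult)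
  from gmean_le_realD[OF this]
  have "(a ^ DIM('a) * (LINT x|lborel. f x powr a)) powr l \<le> 2 ^ DIM('a) * (LINT x|lborel. f x powr 2)"
    using a integral_powr_pos[of a] integral_powr_pos[of 2] by simp
  then have "((a ^ DIM('a) * (LINT x|lborel. f x powr a)) powr l) powr (a - 1)
    \<le> (2 ^ DIM('a) * (LINT x|lborel. f x powr 2)) powr (a - 1)"
    using a by (intro powr_mono2) auto
  moreover have "l * (a - 1) = 1" using a by (simp add: l_def)
  ultimately show ?thesis using a integral_powr_pos[of a] by (simp add: powr_powr)
qed

lemma le_esssup: "ennreal (f x0) \<le> esssup lborel (\<lambda>x. ennreal (f x))"
proof (cases "esssup lborel (\<lambda>x. ennreal (f x))")
  case (real c)
  have "AE x in lborel. ennreal (f x) \<le> ennreal c"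
    using esssup_AE[of "\<lambda>x. ennreal (f x)" lborel] real by simp
  then have "AE x in lborel. f x \<le> c" by eventually_elim (use real in simp)
  then have "f x0 \<le> c" by (rule le_AE_bound)
  then show ?thesis using real by (simp add: ennreal_leI)
qed simp

end

section \<open>The density of the difference\<close>

definition autocorrelation :: "('a::euclidean_space \<Rightarrow> real) \<Rightarrow> 'a \<Rightarrow> real" where
  "autocorrelation f z = (LINT y|lborel. f (z + y) * f y)"

lemma (in log_concave_density) integrable_autocorrelation:
  "integrable lborel (\<lambda>y. f (z + y) * f y)"
proof -
  obtain B where B: "0 < B" "\<And>x. f x \<le> B" using bounded by blast
  show ?thesis
  proof (rule Bochner_Integration.integrable_bound)
    show "integrable lborel (\<lambda>y. B * f y)" by (intro integrable_mult_right integrable)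
    show "AE y in lborel. norm (f (z + y) * f y) \<le> norm (B * f y)"
      using B nonneg by (intro AE_I2) (simp add: abs_mult mult_right_mono)
  qed measurable
qed

lemma (in log_concave_density) nn_integral_autocorrelation:
  "(\<integral>\<^sup>+y. ennreal (f (z + y) * f y) \<partial>lborel) = ennreal (autocorrelation f z)"
  unfolding autocorrelation_def
  by (rule nn_integral_eq_integral[OF integrable_autocorrelation]) (simp add: nonneg)

lemma (in log_concave_density) autocorrelation_nonneg: "0 \<le> autocorrelation f z"
  unfolding autocorrelation_def by (intro integral_nonneg_AE) (simp add: nonneg)

lemma (in log_concave_density) autocorrelation_zero:
  "autocorrelation f 0 = (LINT x|lborel. f x powr 2)"
  unfolding autocorrelation_def by (simp add: nonneg power2_eq_square)

text \<open>
  The function \<open>(z, y) \<mapsto> f (z + y) f y\<close> is jointly log-concave, and by the Prekopa-Leindler inequality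
  integrating out \<open>y\<close> preserves log-concavity.
\<close>

lemma (in log_concave_density) log_concave_density_autocorrelation:
  "log_concave_density (autocorrelation f)"
proof
  show "0 \<le> autocorrelation f x" for x by (rule autocorrelation_nonneg)
  show [measurable]: "autocorrelation f \<in> borel_measurable borel"
    unfolding autocorrelation_def by measurable
  show "log_concave_fun (autocorrelation f)"
    unfolding log_concave_fun_def
  proof (intro allI ballI)
    fix x1 x2 :: 'a and t :: real assume "t \<in> {0<..<1}"
    then have t: "0 < t" "t < 1" by auto
    let ?x = "(1 - t) *\<^sub>R x1 + t *\<^sub>R x2"
    have "gmean_le t (\<integral>\<^sup>+y. ennreal (f (x1 + y) * f y) \<partial>lborel) (\<integral>\<^sup>+y. ennreal (f (x2 + y) * f y) \<partial>lborel)
       (\<integral>\<^sup>+y. ennreal (f (?x + y) * f y) \<partial>lborel)"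
    proof (rule prekopa_leindler[OF _ _ _ t])
      fix y1 y2 :: 'a
      let ?y = "(1 - t) *\<^sub>R y1 + t *\<^sub>R y2"
      show "gmean_le t (ennreal (f (x1 + y1) * f y1)) (ennreal (f (x2 + y2) * f y2)) (ennreal (f (?x + ?y) * f ?y))"
      proof (rule gmean_le_realI)
        have xy: "(1 - t) *\<^sub>R (x1 + y1) + t *\<^sub>R (x2 + y2) = ?x + ?y" by (simp add: scaleR_add_right)
        have "(f (x1 + y1) * f y1) powr (1 - t) * (f (x2 + y2) * f y2) powr t
          = (f (x1 + y1) powr (1 - t) * f (x2 + y2) powr t) * (f y1 powr (1 - t) * f y2 powr t)"
          by (simp add: powr_mult nonneg ac_simps)
        also have "\<dots> \<le> f (?x + ?y) * f ?y"
          using convex_combination[OF t, of "x1 + y1" "x2 + y2"] convex_combination[OF t, of y1 y2] nonneg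
          unfolding xy by (intro mult_mono) auto
        finally show "(f (x1 + y1) * f y1) powr (1 - t) * (f (x2 + y2) * f y2) powr t \<le> f (?x + ?y) * f ?y" .
      qed (use t nonneg in auto)
    qed measurable
    then show "autocorrelation f x1 powr (1 - t) * autocorrelation f x2 powr t \<le> autocorrelation f ?x"
      unfolding nn_integral_autocorrelation by (rule gmean_le_realD) (rule autocorrelation_nonneg)+
  qed
  have "(\<integral>\<^sup>+z. ennreal (autocorrelation f z) \<partial>lborel) = (\<integral>\<^sup>+z. (\<integral>\<^sup>+y. ennreal (f (z + y) * f y) \<partial>lborel) \<partial>lborel)"
    by (simp add: nn_integral_autocorrelation)
  also have "\<dots> = (\<integral>\<^sup>+y. (\<integral>\<^sup>+z. ennreal (f (z + y) * f y) \<partial>lborel) \<partial>lborel)"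
    by (rule lborel_pair.Fubini') measurable
  also have "\<dots> = (\<integral>\<^sup>+y. ennreal (f y) \<partial>lborel)"
  proof (intro nn_integral_cong)
    fix y
    have "(\<integral>\<^sup>+z. ennreal (f (z + y) * f y) \<partial>lborel) = (\<integral>\<^sup>+z. ennreal (f y) * ennreal (f (y + 1 *\<^sub>R z)) \<partial>lborel)"
      by (simp add: ennreal_mult nonneg ac_simps)
    also have "\<dots> = ennreal (f y) * (\<integral>\<^sup>+z. ennreal (f (y + 1 *\<^sub>R z)) \<partial>lborel)"
      by (rule nn_integral_cmult) measurable
    also have "(\<integral>\<^sup>+z. ennreal (f (y + 1 *\<^sub>R z)) \<partial>lborel) = 1"
      by (subst nn_integral_lborel_affine) (auto simp: total_mass)
    finally show "(\<integral>\<^sup>+z. ennreal (f (z + y) * f y) \<partial>lborel) = ennreal (f y)" by simp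
  qed
  finally show "(\<integral>\<^sup>+z. ennreal (autocorrelation f z) \<partial>lborel) = 1" by (simp add: total_mass)
qed

text \<open>
  The joint law is the product of two copies of the density \<open>f\<close>; substitute \<open>x = z + y\<close> and exchange the
  order of integration.
\<close>

lemma distributed_difference:
  fixes X Y :: "'s \<Rightarrow> 'a::euclidean_space"
  assumes "prob_space M" and indep: "prob_space.indep_var M borel X borel Y"
    and same: "distr M borel X = distr M borel Y"
    and X: "distributed M lborel X (\<lambda>x. ennreal (f x))"
    and f: "log_concave_density f"
  shows "distributed M lborel (\<lambda>\<omega>. X \<omega> - Y \<omega>) (\<lambda>z. ennreal (autocorrelation f z))"
proof -
  interpret prob_space M by fact
  interpret f: log_concave_density f by fact
  interpret g: log_concave_density "autocorrelation f" by (rule f.log_concave_density_autocorrelation)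
  have [measurable]: "X \<in> borel_measurable M" "Y \<in> borel_measurable M"
    and joint: "distr M borel X \<Otimes>\<^sub>M distr M borel Y = distr M (borel \<Otimes>\<^sub>M borel) (\<lambda>\<omega>. (X \<omega>, Y \<omega>))"
    using indep unfolding indep_var_distribution_eq by auto
  define D where "D = density lborel (\<lambda>x. ennreal (f x))"
  have sD[measurable_cong]: "sets D = sets borel" by (simp add: D_def)
  have "distr M borel X = distr M lborel X" by (rule distr_cong) auto
  also have "\<dots> = D" using X by (simp add: distributed_distr_eq_density D_def)
  finally have DX: "distr M borel X = D" .
  interpret D: prob_space D unfolding DX[symmetric] by (rule prob_space_distr) simp
  interpret DD: pair_sigma_finite D D by standard
  have "distr M lborel (\<lambda>\<omega>. X \<omega> - Y \<omega>) = density lborel (\<lambda>z. ennreal (autocorrelation f z))"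
  proof (rule measure_eqI)
    fix A assume "A \<in> sets (distr M lborel (\<lambda>\<omega>. X \<omega> - Y \<omega>))"
    then have A[measurable]: "A \<in> sets borel" by simp
    have "emeasure (distr M lborel (\<lambda>\<omega>. X \<omega> - Y \<omega>)) A
        = (\<integral>\<^sup>+z. indicator A z \<partial>distr M lborel (\<lambda>\<omega>. X \<omega> - Y \<omega>))"
      by simp
    also have "\<dots> = (\<integral>\<^sup>+\<omega>. indicator A (X \<omega> - Y \<omega>) \<partial>M)"
      by (subst nn_integral_distr) auto
    also have "\<dots> = (\<integral>\<^sup>+p. indicator A (fst p - snd p) \<partial>distr M (borel \<Otimes>\<^sub>M borel) (\<lambda>\<omega>. (X \<omega>, Y \<omega>)))"
      by (subst nn_integral_distr) auto
    also have "\<dots> = (\<integral>\<^sup>+p. indicator A (fst p - snd p) \<partial>(D \<Otimes>\<^sub>M D))"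
      unfolding joint[symmetric] same[symmetric] DX ..
    also have "\<dots> = (\<integral>\<^sup>+y. (\<integral>\<^sup>+x. indicator A (x - y) \<partial>D) \<partial>D)"
      by (subst DD.nn_integral_snd[symmetric]) auto
    also have "\<dots> = (\<integral>\<^sup>+y. ennreal (f y) * (\<integral>\<^sup>+x. ennreal (f x) * indicator A (x - y) \<partial>lborel) \<partial>lborel)"
      unfolding D_def by (simp add: nn_integral_density)
    also have "\<dots> = (\<integral>\<^sup>+y. (\<integral>\<^sup>+z. ennreal (f (z + y) * f y) * indicator A z \<partial>lborel) \<partial>lborel)"
    proof (intro nn_integral_cong)
      fix y
      have "(\<integral>\<^sup>+x. ennreal (f x) * indicator A (x - y) \<partial>lborel)
         = (\<integral>\<^sup>+z. ennreal (f (y + 1 *\<^sub>R z)) * indicator A (y + 1 *\<^sub>R z - y) \<partial>lborel)"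
        by (subst nn_integral_lborel_affine[where w="\<lambda>x. ennreal (f x) * indicator A (x - y)"]) auto
      then have "ennreal (f y) * (\<integral>\<^sup>+x. ennreal (f x) * indicator A (x - y) \<partial>lborel)
         = ennreal (f y) * (\<integral>\<^sup>+z. ennreal (f (z + y)) * indicator A z \<partial>lborel)"
        by (simp add: add.commute)
      also have "\<dots> = (\<integral>\<^sup>+z. ennreal (f y) * (ennreal (f (z + y)) * indicator A z) \<partial>lborel)"
        by (rule nn_integral_cmult[symmetric]) measurable
      finally show "ennreal (f y) * (\<integral>\<^sup>+x. ennreal (f x) * indicator A (x - y) \<partial>lborel)
         = (\<integral>\<^sup>+z. ennreal (f (z + y) * f y) * indicator A z \<partial>lborel)"
        by (simp add: ennreal_mult f.nonneg ac_simps)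
    qed
    also have "\<dots> = (\<integral>\<^sup>+z. (\<integral>\<^sup>+y. ennreal (f (z + y) * f y) * indicator A z \<partial>lborel) \<partial>lborel)"
      by (rule lborel_pair.Fubini') measurable
    also have "\<dots> = (\<integral>\<^sup>+z. ennreal (autocorrelation f z) * indicator A z \<partial>lborel)"
      by (intro nn_integral_cong, subst nn_integral_multc) (auto simp: f.nn_integral_autocorrelation)
    also have "\<dots> = emeasure (density lborel (\<lambda>z. ennreal (autocorrelation f z))) A"
      by (subst emeasure_density) auto
    finally show "emeasure (distr M lborel (\<lambda>\<omega>. X \<omega> - Y \<omega>)) A
       = emeasure (density lborel (\<lambda>z. ennreal (autocorrelation f z))) A" .
  qed simp
  then show ?thesis unfolding distributed_def by auto
qed

section \<open>Entropies of log-concave densities\<close>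

lemma log_concave_densityI:
  assumes "prob_space M" and X: "distributed M lborel X (\<lambda>x. ennreal (f x))"
    and nn: "\<And>x. 0 \<le> f x" and lc: "log_concave_fun f"
  shows "log_concave_density f"
proof
  interpret prob_space M by fact
  have [measurable]: "X \<in> borel_measurable M" using X by (simp add: distributed_def)
  have m: "(\<lambda>x. ennreal (f x)) \<in> borel_measurable borel" using X by (simp add: distributed_def)
  have "(\<lambda>x. enn2real (ennreal (f x))) \<in> borel_measurable borel" using m by measurable
  then show "f \<in> borel_measurable borel" by (simp add: nn)
  interpret D: prob_space "distr M lborel X" by (rule prob_space_distr) simp
  have "(\<integral>\<^sup>+x. ennreal (f x) \<partial>lborel) = emeasure (density lborel (\<lambda>x. ennreal (f x))) UNIV"
    using m by (subst emeasure_density) auto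
  also have "\<dots> = emeasure (distr M lborel X) (space (distr M lborel X))"
    using X by (simp add: distributed_distr_eq_density)
  also have "\<dots> = 1" by (rule D.emeasure_space_1)
  finally show "(\<integral>\<^sup>+x. ennreal (f x) \<partial>lborel) = 1" .
qed (use nn lc in auto)

lemma renyi_entropy_density_cong_AE:
  fixes f g :: "'a::euclidean_space \<Rightarrow> real"
  assumes [measurable]: "f \<in> borel_measurable borel" "g \<in> borel_measurable borel"
    and ae: "AE x in lborel. f x = g x"
  shows "renyi_entropy_density b \<alpha> f = renyi_entropy_density b \<alpha> g"
proof -
  have "emeasure lborel {x. 0 < f x} = emeasure lborel {x. 0 < g x}"
    by (rule emeasure_eq_AE) (use ae in auto)
  moreover have "(\<integral>\<^sup>+x. ennreal (w (f x)) \<partial>lborel) = (\<integral>\<^sup>+x. ennreal (w (g x)) \<partial>lborel)" for w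
    by (rule nn_integral_cong_AE) (use ae in auto)
  note this[of "\<lambda>y. - (y * log b y)"] this[of "\<lambda>y. y * log b y"] this[of "\<lambda>y. y powr enn2real \<alpha>"]
  moreover have "esssup lborel (\<lambda>x. ennreal (f x)) = esssup lborel (\<lambda>x. ennreal (g x))"
    by (rule esssup_AE_cong) (use ae in auto)
  ultimately show ?thesis unfolding renyi_entropy_density_def by simp
qed

lemma renyi_entropy_distributed:
  fixes Y :: "'s \<Rightarrow> 'a::euclidean_space"
  assumes Y: "distributed M lborel Y (\<lambda>x. ennreal (f x))" and f: "log_concave_density f"
  shows "renyi_entropy M b \<alpha> Y = renyi_entropy_density b \<alpha> f"
proof -
  interpret log_concave_density f by fact
  have D: "distr M lborel Y = distr M borel Y" by (rule distr_cong) auto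
  have "AE x in lborel. ennreal (f x) = RN_deriv lborel (distr M lborel Y) x"
    using Y by (intro sigma_finite_measure.RN_deriv_unique[OF sigma_finite_lborel]) (auto simp: distributed_distr_eq_density)
  then have "AE x in lborel. enn2real (RN_deriv lborel (distr M lborel Y) x) = f x"
    by eventually_elim (metis enn2real_ennreal nonneg)
  then show ?thesis unfolding renyi_entropy_def
    by (intro renyi_entropy_density_cong_AE) auto
qed

lemma elog_ennreal: "0 < x \<Longrightarrow> elog b (ennreal x) = ereal (log b x)"
  by (simp add: elog_def)

context log_concave_density
begin

lemma renyi_entropy_density_real:
  assumes "0 < a" "a \<noteq> 1"
  shows "renyi_entropy_density b (ennreal a) f = ereal (ln (LINT x|lborel. f x powr a) / (1 - a) / ln b)"
proof -
  have "ennreal a \<noteq> 0" "ennreal a \<noteq> 1" "ennreal a \<noteq> \<infinity>" "enn2real (ennreal a) = a"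
    using assms by (auto simp: ennreal_eq_1)
  then show ?thesis
    using assms integral_powr_pos[of a]
    unfolding renyi_entropy_density_def by (simp add: nn_integral_powr elog_ennreal log_def)
qed

lemma renyi_entropy_density_one:
  assumes "1 < b"
  shows "renyi_entropy_density b 1 f = ereal (- (LINT x|lborel. f x * ln (f x)) / ln b)"
proof -
  define h where "h x = - (f x * log b (f x))" for x
  have h: "h = (\<lambda>x. - (f x * ln (f x)) / ln b)" by (simp add: h_def log_def fun_eq_iff)
  have "integrable lborel h" unfolding h using integrable_entropy by auto
  then have "integrable lborel h" "(\<integral>\<^sup>+x. ennreal (h x) \<partial>lborel) \<noteq> \<infinity>" "(\<integral>\<^sup>+x. ennreal (- h x) \<partial>lborel) \<noteq> \<infinity>"
    by (auto simp: real_integrable_def)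
  then have "enn2ereal (\<integral>\<^sup>+x. ennreal (h x) \<partial>lborel) - enn2ereal (\<integral>\<^sup>+x. ennreal (- h x) \<partial>lborel)
      = ereal (LINT x|lborel. h x)"
    unfolding real_lebesgue_integral_def[OF \<open>integrable lborel h\<close>]
    by (cases "\<integral>\<^sup>+x. ennreal (h x) \<partial>lborel"; cases "\<integral>\<^sup>+x. ennreal (- h x) \<partial>lborel") (auto simp: enn2ereal_ennreal)
  moreover have "(LINT x|lborel. h x) = - (LINT x|lborel. f x * ln (f x)) / ln b"
    unfolding h by simp
  ultimately show ?thesis unfolding renyi_entropy_density_def h_def by simp
qed

text \<open>
  The essential supremum is the least upper bound of all values, by \<open>le_AE_bound\<close>.
\<close>

lemma renyi_entropy_density_infinity:
  obtains S where "0 < S" "\<And>x. f x \<le> S" "\<And>B. (\<And>x. f x \<le> B) \<Longrightarrow> S \<le> B"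
    "renyi_entropy_density b \<infinity> f = ereal (- log b S)"
proof -
  have bound: "esssup lborel (\<lambda>x. ennreal (f x)) \<le> ennreal B" if "\<And>x. f x \<le> B" for B
    by (rule esssup_I) (auto intro: ennreal_leI that)
  obtain B0 where B0: "0 < B0" "\<And>x. f x \<le> B0" using bounded by blast
  obtain S where S: "esssup lborel (\<lambda>x. ennreal (f x)) = ennreal S" "0 \<le> S"
    using bound[OF B0(2)] by (cases "esssup lborel (\<lambda>x. ennreal (f x))") (auto simp: top_unique)
  have le: "f x \<le> S" for x using le_esssup[of x] S by simp
  obtain x0 where "0 < f x0" by (rule exists_positive)
  then have "0 < S" using le[of x0] by simp
  show thesis
  proof (rule that[OF \<open>0 < S\<close> le])
    fix B assume B: "\<And>x. f x \<le> B"
    then have "0 \<le> B" using \<open>0 < f x0\<close> by (meson less_imp_le order_trans)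
    then show "S \<le> B" using bound[OF B] S by simp
  next
    show "renyi_entropy_density b \<infinity> f = ereal (- log b S)" using \<open>0 < S\<close>
      unfolding renyi_entropy_density_def by (simp add: S elog_ennreal)
  qed
qed

end

section \<open>The entropy bounds\<close>

lemma divide_one_minus:
  fixes a :: real
  assumes "a \<noteq> 1"
  shows "(x + (a - 1) * k) / (1 - a) = x / (1 - a) - k"
proof -
  have "x + (a - 1) * k = x - k * (1 - a)" by (simp add: algebra_simps)
  then show ?thesis using assms by (simp add: diff_divide_distrib)
qed

context log_concave_density
begin

text \<open>
  With \<open>c = \<integral> f\<^sup>2\<close>, the interpolation inequality bounds \<open>\<integral> f\<^bsup>a\<^esup>\<close> by \<open>a\<^bsup>-d\<^esup> (2\<^sup>d c)\<^bsup>a - 1\<^esup>\<close>, while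
  \<open>\<integral> g\<^bsup>a\<^esup> \<ge> a\<^bsup>-d\<^esup> c\<^bsup>a - 1\<^esup>\<close> since \<open>g 0 = c\<close>. The factors \<open>a\<^bsup>-d\<^esup>\<close> cancel. At \<open>a = 2\<close> the first inequality is an
  identity.
\<close>

lemma difference_entropy_upper_real:
  assumes b: "1 < b" and a: "2 \<le> a"
  shows "renyi_entropy_density b (ennreal a) (autocorrelation f)
    \<le> renyi_entropy_density b (ennreal a) f + ereal (real DIM('a) * log b 2)"
proof -
  interpret g: log_concave_density "autocorrelation f" by (rule log_concave_density_autocorrelation)
  define d where "d = real DIM('a)"
  define c where "c = (LINT x|lborel. f x powr 2)"
  define If where "If = (LINT x|lborel. f x powr a)"
  define Ig where "Ig = (LINT x|lborel. autocorrelation f x powr a)"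
  have pos: "0 < c" "0 < If" "0 < Ig"
    unfolding c_def If_def Ig_def using a by (auto intro!: integral_powr_pos g.integral_powr_pos)
  have 1: "inverse a ^ DIM('a) * c powr (a - 1) \<le> Ig"
    using g.integral_powr_lower[of a 0] a pos by (simp add: autocorrelation_zero c_def Ig_def)
  have 2: "a ^ DIM('a) * If \<le> (2 ^ DIM('a) * c) powr (a - 1)"
  proof (cases "a = 2")
    case True
    then show ?thesis using pos by (simp add: If_def c_def)
  next
    case False
    then show ?thesis using integral_powr_interpolation[of a] a by (simp add: If_def c_def)
  qed
  have "ln (a ^ DIM('a) * If) \<le> ln ((2 ^ DIM('a) * c) powr (a - 1))"
    using 2 pos a by (intro ln_mono) auto
  then have 3: "d * ln a + ln If \<le> (a - 1) * (d * ln 2 + ln c)"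
    using pos a by (simp add: ln_mult ln_powr ln_realpow d_def)
  have "ln (inverse a ^ DIM('a) * c powr (a - 1)) \<le> ln Ig"
    using 1 pos a by (intro ln_mono) auto
  then have 4: "- d * ln a + (a - 1) * ln c \<le> ln Ig"
    using pos a by (simp add: ln_mult ln_powr ln_realpow ln_inverse d_def)
  from 3 4 have "ln If + (a - 1) * (- (d * ln 2)) \<le> ln Ig" by (simp add: algebra_simps)
  then have "ln Ig / (1 - a) \<le> (ln If + (a - 1) * (- (d * ln 2))) / (1 - a)"
    using a by (intro divide_right_mono_neg) auto
  also have "\<dots> = ln If / (1 - a) + d * ln 2" using a by (subst divide_one_minus) auto
  finally have "ln Ig / (1 - a) \<le> ln If / (1 - a) + d * ln 2" .
  then have "ln Ig / (1 - a) / ln b \<le> (ln If / (1 - a) + d * ln 2) / ln b"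
    using b by (intro divide_right_mono) auto
  then show ?thesis
    using a b g.renyi_entropy_density_real[of a b] renyi_entropy_density_real[of a b]
    by (simp add: If_def[symmetric] Ig_def[symmetric] d_def log_def add_divide_distrib)
qed

text \<open>
  The lower bound for \<open>\<integral> f\<^sup>2\<close> in terms of any value of \<open>f\<close> gives \<open>sup f \<le> 2\<^sup>d c = 2\<^sup>d g 0\<close>.
\<close>

lemma difference_entropy_upper_infinity:
  assumes b: "1 < b"
  shows "renyi_entropy_density b \<infinity> (autocorrelation f)
    \<le> renyi_entropy_density b \<infinity> f + ereal (real DIM('a) * log b 2)"
proof -
  interpret g: log_concave_density "autocorrelation f" by (rule log_concave_density_autocorrelation)
  define c where "c = (LINT x|lborel. f x powr 2)"
  have c: "0 < c" unfolding c_def by (rule integral_powr_pos) simp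
  obtain S where S: "0 < S" "\<And>x. f x \<le> S" "\<And>B. (\<And>x. f x \<le> B) \<Longrightarrow> S \<le> B"
    "renyi_entropy_density b \<infinity> f = ereal (- log b S)"
    by (rule renyi_entropy_density_infinity) blast
  obtain T where T: "0 < T" "\<And>x. autocorrelation f x \<le> T" "\<And>B. (\<And>x. autocorrelation f x \<le> B) \<Longrightarrow> T \<le> B"
    "renyi_entropy_density b \<infinity> (autocorrelation f) = ereal (- log b T)"
    by (rule g.renyi_entropy_density_infinity) blast
  have "S \<le> 2 ^ DIM('a) * c"
  proof (rule S(3))
    fix x
    show "f x \<le> 2 ^ DIM('a) * c"
    proof (cases "f x = 0")
      case False
      then have "inverse 2 ^ DIM('a) * f x powr (2 - 1) \<le> c"
        unfolding c_def using nonneg[of x] by (intro integral_powr_lower) auto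
      then show ?thesis using nonneg[of x] by (simp add: power_inverse field_simps)
    qed (use c in simp)
  qed
  also have "c \<le> T" using T(2)[of 0] by (simp add: autocorrelation_zero c_def)
  finally have "S \<le> 2 ^ DIM('a) * T" by simp
  then have "log b S \<le> log b (2 ^ DIM('a) * T)" using b S T by simp
  also have "\<dots> = DIM('a) * log b 2 + log b T" using b T by (simp add: log_mult log_nat_power)
  finally show ?thesis unfolding S(4) T(4) by simp
qed

text \<open>
  Here \<open>h\<^sub>a(X - Y) \<le> - log c + d log a / (a - 1)\<close> by the bounds at the point \<open>0\<close>, and \<open>- log c = h\<^sub>2(X) \<le> h\<^sub>a(X)\<close>.
  The signs of \<open>1 - a\<close> differ on the two sides of \<open>a = 1\<close>, hence the separate cases. For \<open>a = 0\<close> the right-hand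
  side is \<open>\<infinity>\<close>.
\<close>

lemma difference_entropy_upper_low_order:
  assumes b: "1 < b" and a: "0 \<le> a" "a \<le> 2"
  shows "renyi_entropy_density b (ennreal a) (autocorrelation f)
    \<le> renyi_entropy_density b (ennreal a) f + ereal (real DIM('a)) * elog b (renyi_const a)"
proof -
  interpret g: log_concave_density "autocorrelation f" by (rule log_concave_density_autocorrelation)
  define d where "d = real DIM('a)"
  define c where "c = (LINT x|lborel. f x powr 2)"
  have c: "0 < c" unfolding c_def by (rule integral_powr_pos) simp
  have g0: "autocorrelation f 0 = c" by (simp add: c_def autocorrelation_zero)
  have lnb: "0 < ln b" using b by simp
  consider "a = 0" | "a = 1" | "0 < a" "a < 1" | "1 < a" using a by linarith
  then show ?thesis
  proof cases
    case 1
    have "elog b (renyi_const a) = \<infinity>" by (simp add: 1 renyi_const_def elog_def)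
    then have "ereal (real DIM('a)) * elog b (renyi_const a) = \<infinity>" by simp
    then show ?thesis by simp
  next
    case 2
    have "- (LINT x|lborel. autocorrelation f x * ln (autocorrelation f x))
        \<le> - (LINT x|lborel. f x * ln (f x)) + d"
      using g.entropy_upper[of 0] entropy_collision_lower c by (simp add: g0 c_def d_def)
    then have "- (LINT x|lborel. autocorrelation f x * ln (autocorrelation f x)) / ln b
        \<le> (- (LINT x|lborel. f x * ln (f x)) + d) / ln b"
      using lnb by (intro divide_right_mono) auto
    moreover have "elog b (renyi_const a) = ereal (1 / ln b)"
      by (simp add: 2 renyi_const_def elog_ennreal log_def)
    ultimately show ?thesis
      using g.renyi_entropy_density_one[OF b] renyi_entropy_density_one[OF b]
      by (simp add: 2 d_def add_divide_distrib diff_divide_distrib)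
  next
    case 3
    define If where "If = (LINT x|lborel. f x powr a)"
    define Ig where "Ig = (LINT x|lborel. autocorrelation f x powr a)"
    have pos: "0 < If" "0 < Ig"
      unfolding If_def Ig_def using 3 by (auto intro!: integral_powr_pos g.integral_powr_pos)
    have "Ig \<le> inverse a ^ DIM('a) * c powr (a - 1)"
      using g.integral_powr_upper[of a 0] 3 c by (simp add: g0 Ig_def)
    then have "ln Ig \<le> ln (inverse a ^ DIM('a) * c powr (a - 1))"
      using pos by (intro ln_mono) auto
    also have "\<dots> = - d * ln a + ln (c powr (a - 1))"
      using c 3 by (simp add: ln_mult ln_realpow ln_inverse d_def)
    also have "ln (c powr (a - 1)) \<le> ln If"
      using integral_powr_collision_lower[of a] 3 c by (intro ln_mono) (auto simp: c_def If_def)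
    finally have "ln Ig \<le> - d * ln a + ln If" by simp
    then have "ln Ig / (1 - a) \<le> (- d * ln a + ln If) / (1 - a)"
      using 3 by (intro divide_right_mono) auto
    also have "- d * ln a + ln If = ln If + (a - 1) * (- (d * (ln a / (a - 1))))" using 3 by simp
    also have "\<dots> / (1 - a) = ln If / (1 - a) + d * (ln a / (a - 1))"
      using 3 by (subst divide_one_minus) auto
    finally have "ln Ig / (1 - a) / ln b \<le> (ln If / (1 - a) + d * (ln a / (a - 1))) / ln b"
      using lnb by (intro divide_right_mono) auto
    moreover have "elog b (renyi_const a) = ereal (ln a / (a - 1) / ln b)"
      using 3 by (simp add: renyi_const_def elog_ennreal log_def ln_powr)
    ultimately show ?thesis
      using 3 g.renyi_entropy_density_real[of a b] renyi_entropy_density_real[of a b]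
      by (simp add: If_def[symmetric] Ig_def[symmetric] d_def add_divide_distrib)
  next
    case 4
    define If where "If = (LINT x|lborel. f x powr a)"
    define Ig where "Ig = (LINT x|lborel. autocorrelation f x powr a)"
    have pos: "0 < If" "0 < Ig"
      unfolding If_def Ig_def using 4 by (auto intro!: integral_powr_pos g.integral_powr_pos)
    have "ln If \<le> ln (c powr (a - 1))"
      using integral_powr_collision_upper[of a] 4 a pos by (intro ln_mono) (auto simp: c_def If_def)
    then have "- d * ln a + ln If \<le> - d * ln a + ln (c powr (a - 1))" by simp
    also have "\<dots> = ln (inverse a ^ DIM('a) * c powr (a - 1))"
      using c 4 by (simp add: ln_mult ln_realpow ln_inverse d_def)
    also have "\<dots> \<le> ln Ig"
      using g.integral_powr_lower[of a 0] 4 c by (intro ln_mono) (auto simp: g0 Ig_def)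
    finally have "ln Ig / (1 - a) \<le> (- d * ln a + ln If) / (1 - a)"
      using 4 by (intro divide_right_mono_neg) auto
    also have "- d * ln a + ln If = ln If + (a - 1) * (- (d * (ln a / (a - 1))))" using 4 by simp
    also have "\<dots> / (1 - a) = ln If / (1 - a) + d * (ln a / (a - 1))"
      using 4 by (subst divide_one_minus) auto
    finally have "ln Ig / (1 - a) / ln b \<le> (ln If / (1 - a) + d * (ln a / (a - 1))) / ln b"
      using lnb by (intro divide_right_mono) auto
    moreover have "elog b (renyi_const a) = ereal (ln a / (a - 1) / ln b)"
      using 4 by (simp add: renyi_const_def elog_ennreal log_def ln_powr)
    ultimately show ?thesis
      using 4 g.renyi_entropy_density_real[of a b] renyi_entropy_density_real[of a b]
      by (simp add: If_def[symmetric] Ig_def[symmetric] d_def add_divide_distrib)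
  qed
qed

end

section \<open>The exponential distribution\<close>

lemma exp_density_outside: "\<not> (\<forall>i. 0 < x $ i) \<Longrightarrow> exp_density x = 0"
  by (simp add: exp_density_def)

lemma log_concave_exp_density: "log_concave_fun (exp_density :: real ^ 'n \<Rightarrow> real)"
  unfolding log_concave_fun_def
proof (intro allI ballI)
  fix x y :: "real ^ 'n" and t :: real assume "t \<in> {0<..<1}"
  then have t: "0 < t" "t < 1" by auto
  show "exp_density x powr (1 - t) * exp_density y powr t \<le> exp_density ((1 - t) *\<^sub>R x + t *\<^sub>R y)"
  proof (cases "(\<forall>i. 0 < x $ i) \<and> (\<forall>i. 0 < y $ i)")
    case True
    then have "0 < (1 - t) * x $ i + t * y $ i" for i using t by (simp add: add_pos_pos)
    then have "exp_density ((1 - t) *\<^sub>R x + t *\<^sub>R y) = exp (- (\<Sum>i\<in>UNIV. (1 - t) * x $ i + t * y $ i))"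
      by (simp add: exp_density_def)
    also have "(\<Sum>i\<in>UNIV. (1 - t) * x $ i + t * y $ i) = (1 - t) * (\<Sum>i\<in>UNIV. x $ i) + t * (\<Sum>i\<in>UNIV. y $ i)"
      by (simp add: sum.distrib sum_distrib_left)
    also have "exp (- \<dots>) = exp_density x powr (1 - t) * exp_density y powr t"
      using True by (simp add: exp_density_def exp_powr_real exp_add[symmetric] algebra_simps)
    finally show ?thesis by simp
  next
    case False
    then have "exp_density x = 0 \<or> exp_density y = 0" using exp_density_outside by blast
    moreover have "0 \<le> exp_density ((1 - t) *\<^sub>R x + t *\<^sub>R y)" by (simp add: exp_density_def)
    ultimately show ?thesis by auto
  qed
qed

lemma exp_density_powr:
  assumes "0 < a"
  shows "exp_density x powr a = exp_density (a *\<^sub>R x)"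
  using assms by (auto simp: exp_density_def indicator_def exp_powr_real zero_less_mult_iff sum_distrib_left ac_simps)

text \<open>
  Translate the integration variable by the coordinatewise negative part \<open>m\<close> of \<open>z\<close>. Then \<open>z + m\<close> is the positive
  part, in every coordinate one of the two vanishes, so the common support of both factors becomes the orthant
  itself, and the exponents add up to \<open>\<bar>z\<^sub>i\<bar> + 2 w\<^sub>i\<close>.
\<close>

lemma autocorrelation_exp_density:
  fixes z :: "real ^ 'n"
  shows "autocorrelation exp_density z
    = (LINT w|lborel. exp_density (w :: real ^ 'n) powr 2) * exp (- (\<Sum>i\<in>UNIV. \<bar>z $ i\<bar>))"
proof -
  define m :: "real ^ 'n" where "m = (\<chi> i. max 0 (- z $ i))"
  have pt: "exp_density (z + (m + w)) * exp_density (m + w)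
      = exp_density w powr 2 * exp (- (\<Sum>i\<in>UNIV. \<bar>z $ i\<bar>))" for w
  proof (cases "\<forall>i. 0 < w $ i")
    case True
    have "0 < z $ i + (m $ i + w $ i)" "0 < m $ i + w $ i" for i
      using True[rule_format, of i] by (auto simp: m_def max_def)
    moreover have "(\<Sum>i\<in>UNIV. z $ i + (m $ i + w $ i)) + (\<Sum>i\<in>UNIV. m $ i + w $ i)
        = (\<Sum>i\<in>UNIV. 2 * w $ i) + (\<Sum>i\<in>UNIV. \<bar>z $ i\<bar>)"
      unfolding sum.distrib[symmetric] by (intro sum.cong) (auto simp: m_def max_def)
    ultimately show ?thesis using True
      by (subst exp_density_powr) (auto simp: exp_density_def exp_add[symmetric] algebra_simps)
  next
    case False
    then obtain i where i: "w $ i \<le> 0" by (auto simp: not_less)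
    have "z $ i + (m $ i + w $ i) \<le> 0 \<or> m $ i + w $ i \<le> 0"
      using i by (auto simp: m_def max_def)
    then have "\<not> (\<forall>i. 0 < (z + (m + w)) $ i) \<or> \<not> (\<forall>i. 0 < (m + w) $ i)" by (auto simp: not_less)
    then have "exp_density (z + (m + w)) = 0 \<or> exp_density (m + w) = 0" using exp_density_outside by blast
    moreover have "exp_density w = 0" using False by (simp add: exp_density_def)
    ultimately show ?thesis by auto
  qed
  have [measurable]: "(exp_density :: real ^ 'n \<Rightarrow> real) \<in> borel_measurable borel"
    unfolding exp_density_def by measurable
  have "autocorrelation exp_density z = (LINT y|distr lborel borel ((+) m). exp_density (z + y) * exp_density y)"
    unfolding autocorrelation_def lborel_distr_plus ..
  also have "\<dots> = (LINT w|lborel. exp_density (z + (m + w)) * exp_density (m + w))"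
    by (rule integral_distr) measurable
  also have "\<dots> = (LINT w|lborel. exp_density (w :: real ^ 'n) powr 2) * exp (- (\<Sum>i\<in>UNIV. \<bar>z $ i\<bar>))"
    unfolding pt by simp
  finally show ?thesis .
qed

text \<open>
  Powers of \<open>f\<close>, and of \<open>g / c\<close>, are dilates of the functions themselves. Since \<open>f\<close> and \<open>g\<close> have mass one, this gives
  \<open>\<integral> f\<^bsup>a\<^esup> = a\<^bsup>-d\<^esup>\<close> and \<open>\<integral> g\<^bsup>a\<^esup> = c\<^bsup>a - 1\<^esup> a\<^bsup>-d\<^esup>\<close> with \<open>c = 2\<^bsup>-d\<^esup>\<close>. For infinite order the suprema are \<open>1\<close>, approached at
  the corner of the orthant, and \<open>c\<close>.
\<close>

lemma exp_density_difference_entropy_lower: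
  fixes b :: real and \<alpha> :: ennreal
  assumes f: "log_concave_density (exp_density :: real ^ 'n \<Rightarrow> real)" and b: "1 < b" and \<alpha>: "2 \<le> \<alpha>"
  shows "renyi_entropy_density b \<alpha> (exp_density :: real ^ 'n \<Rightarrow> real) + ereal (real CARD('n) * log b 2)
    \<le> renyi_entropy_density b \<alpha> (autocorrelation (exp_density :: real ^ 'n \<Rightarrow> real))"
proof -
  let ?f = "exp_density :: real ^ 'n \<Rightarrow> real"
  interpret log_concave_density ?f by fact
  interpret g: log_concave_density "autocorrelation ?f" by (rule log_concave_density_autocorrelation)
  define d where "d = CARD('n)"
  have mass: "(LINT x|lborel. ?f x powr a) = inverse a ^ d" if a: "0 < a" for a
  proof -
    have "ennreal (LINT x|lborel. ?f x powr a) = (\<integral>\<^sup>+x. ennreal (?f (0 + a *\<^sub>R x)) \<partial>lborel)"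
      unfolding nn_integral_powr[OF a, symmetric] by (simp add: exp_density_powr a)
    also have "\<dots> = ennreal (inverse a ^ d)"
      using a by (subst nn_integral_lborel_affine) (auto simp: total_mass d_def)
    finally show ?thesis using a integral_powr_pos[OF a] by simp
  qed
  define c where "c = (inverse 2 :: real) ^ d"
  have c: "0 < c" by (simp add: c_def)
  have "ln c = ln (inverse (2 ^ d))" by (simp only: c_def power_inverse)
  also have "\<dots> = - (d * ln 2)" by (subst ln_inverse) (auto simp: ln_realpow)
  finally have ln_c: "ln c = - (d * ln 2)" .
  have g: "autocorrelation ?f z = c * exp (- (\<Sum>i\<in>UNIV. \<bar>z $ i\<bar>))" for z
    unfolding autocorrelation_exp_density by (simp add: mass c_def)
  show ?thesis
  proof (cases \<alpha>)
    case (real a)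
    then have a: "2 \<le> a" using \<alpha> by (metis ennreal_le_iff ennreal_numeral)
    have "ennreal (LINT x|lborel. autocorrelation ?f x powr a)
        = (\<integral>\<^sup>+x. ennreal (c powr (a - 1)) * ennreal (autocorrelation ?f (0 + a *\<^sub>R x)) \<partial>lborel)"
    proof (subst g.nn_integral_powr[symmetric])
      have "autocorrelation ?f x powr a = c powr (a - 1) * autocorrelation ?f (a *\<^sub>R x)" for x
      proof -
        have "autocorrelation ?f x powr a = c powr a * exp (- (\<Sum>i\<in>UNIV. \<bar>x $ i\<bar>)) powr a"
          unfolding g using c by (simp add: powr_mult)
        also have "c powr a = c powr (a - 1) * c" using c by (simp add: powr_minus_one_mult)
        also have "exp (- (\<Sum>i\<in>UNIV. \<bar>x $ i\<bar>)) powr a = exp (- (\<Sum>i\<in>UNIV. \<bar>(a *\<^sub>R x) $ i\<bar>))"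
          using a by (simp add: exp_powr_real abs_mult sum_distrib_left mult.commute)
        finally show ?thesis unfolding g by simp
      qed
      then show "(\<integral>\<^sup>+x. ennreal (autocorrelation ?f x powr a) \<partial>lborel)
        = (\<integral>\<^sup>+x. ennreal (c powr (a - 1)) * ennreal (autocorrelation ?f (0 + a *\<^sub>R x)) \<partial>lborel)"
        by (simp add: ennreal_mult g.nonneg)
    qed (use a in simp)
    also have "\<dots> = ennreal (c powr (a - 1)) * (\<integral>\<^sup>+x. ennreal (autocorrelation ?f (0 + a *\<^sub>R x)) \<partial>lborel)"
      by (rule nn_integral_cmult) measurable
    also have "\<dots> = ennreal (c powr (a - 1) * inverse a ^ d)"
      using a by (subst nn_integral_lborel_affine) (auto simp: g.total_mass d_def ennreal_mult)
    finally have Ig: "(LINT x|lborel. autocorrelation ?f x powr a) = c powr (a - 1) * inverse a ^ d"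
      using a g.integral_powr_pos[of a] by simp
    have "ln (c powr (a - 1) * inverse a ^ d) / (1 - a) = ln (inverse a ^ d) / (1 - a) + d * ln 2"
    proof -
      have "ln (c powr (a - 1) * inverse a ^ d) = ln (inverse a ^ d) + (1 - a) * (d * ln 2)"
        using a c by (simp add: ln_mult ln_powr ln_c algebra_simps)
      then show ?thesis using a by (simp add: add_divide_distrib)
    qed
    then have "ln (c powr (a - 1) * inverse a ^ d) / (1 - a) / ln b
        = ln (inverse a ^ d) / (1 - a) / ln b + d * log b 2"
      by (simp add: add_divide_distrib log_def)
    then show ?thesis
      using a g.renyi_entropy_density_real[of a b] renyi_entropy_density_real[of a b]
      by (simp add: real Ig mass d_def)
  next
    case top
    obtain S where S: "0 < S" "\<And>x. ?f x \<le> S" "renyi_entropy_density b \<infinity> ?f = ereal (- log b S)"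
      by (rule renyi_entropy_density_infinity) blast
    obtain T where T: "0 < T" "\<And>B. (\<And>x. autocorrelation ?f x \<le> B) \<Longrightarrow> T \<le> B"
      "renyi_entropy_density b \<infinity> (autocorrelation ?f) = ereal (- log b T)"
      by (rule g.renyi_entropy_density_infinity) blast
    have "T \<le> c"
    proof (rule T(2))
      fix z show "autocorrelation ?f z \<le> c" unfolding g using c by (simp add: sum_nonneg)
    qed
    have "1 \<le> S"
    proof (rule tendsto_upperbound)
      have "((\<lambda>e::real. exp (- (d * e))) \<longlongrightarrow> exp (- (d * (0::real)))) (at_right 0)"
        by (intro tendsto_intros)
      then show "((\<lambda>e::real. exp (- (d * e))) \<longlongrightarrow> 1) (at_right 0)" by simp
      have "exp (- (d * e)) \<le> S" if "0 < e" for e :: real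
        using S(2)[of "\<chi> i. e"] that by (simp add: exp_density_def d_def)
      then show "\<forall>\<^sub>F e::real in at_right 0. exp (- (d * e)) \<le> S"
        using eventually_at_right_less[of "0::real"] by (auto elim: eventually_mono)
    qed simp
    have "log b T \<le> log b c" using b T(1) c \<open>T \<le> c\<close> by simp
    also have "\<dots> = - d * log b 2" by (simp add: log_def ln_c)
    finally have "log b T \<le> - d * log b 2" .
    moreover have "0 \<le> log b S" using b \<open>1 \<le> S\<close> by simp
    ultimately show ?thesis using S(3) T(3) by (simp add: top d_def infinity_ennreal_def)
  qed
qed

theorem theorem6p1:
  fixes M :: "'s measure" and X Y :: "'s \<Rightarrow> real ^ 'n" and b :: real
  assumes "prob_space M"
    and "b > 1"
    and "log_concave_vector M X" and "log_concave_vector M Y"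
    and "prob_space.indep_var M borel X borel Y"
    and "distr M borel X = distr M borel Y"
  shows "(\<forall>\<alpha>::ennreal. 2 \<le> \<alpha> \<longrightarrow>
            renyi_entropy M b \<alpha> (\<lambda>\<omega>. X \<omega> - Y \<omega>)
              \<le> renyi_entropy M b \<alpha> X + ereal (real CARD('n) * log b 2)
            \<and> (distributed M lborel X (\<lambda>x. ennreal (exp_density x)) \<longrightarrow>
                 renyi_entropy M b \<alpha> (\<lambda>\<omega>. X \<omega> - Y \<omega>)
                   = renyi_entropy M b \<alpha> X + ereal (real CARD('n) * log b 2)))
       \<and> (\<forall>\<alpha>::real. 0 \<le> \<alpha> \<and> \<alpha> \<le> 2 \<longrightarrow>
            renyi_entropy M b (ennreal \<alpha>) (\<lambda>\<omega>. X \<omega> - Y \<omega>)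
              \<le> renyi_entropy M b (ennreal \<alpha>) X
                 + ereal (real CARD('n)) * elog b (renyi_const \<alpha>))"
proof -
  obtain f where f: "\<And>x. 0 \<le> f x" "log_concave_fun f" "distributed M lborel X (\<lambda>x. ennreal (f x))"
    using assms(3) unfolding log_concave_vector_def by blast
  have entropies: "renyi_entropy M b \<alpha> X = renyi_entropy_density b \<alpha> h"
      "renyi_entropy M b \<alpha> (\<lambda>\<omega>. X \<omega> - Y \<omega>) = renyi_entropy_density b \<alpha> (autocorrelation h)"
    if h: "log_concave_density h" "distributed M lborel X (\<lambda>x. ennreal (h x))" for h \<alpha>
  proof -
    show "renyi_entropy M b \<alpha> X = renyi_entropy_density b \<alpha> h"
      by (rule renyi_entropy_distributed[OF h(2,1)])
    show "renyi_entropy M b \<alpha> (\<lambda>\<omega>. X \<omega> - Y \<omega>) = renyi_entropy_density b \<alpha> (autocorrelation h)"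
      by (intro renyi_entropy_distributed distributed_difference[OF assms(1,5,6) h(2,1)]
          log_concave_density.log_concave_density_autocorrelation h(1))
  qed
  have lf: "log_concave_density f" by (rule log_concave_densityI[OF assms(1) f(3,1,2)])
  interpret log_concave_density f by (rule lf)
  note ent = entropies[OF lf f(3)]
  have high: "renyi_entropy M b \<alpha> (\<lambda>\<omega>. X \<omega> - Y \<omega>)
      \<le> renyi_entropy M b \<alpha> X + ereal (real CARD('n) * log b 2)" if "2 \<le> \<alpha>" for \<alpha> :: ennreal
  proof (cases \<alpha>)
    case (real a)
    then have "2 \<le> a" using that by (metis ennreal_le_iff ennreal_numeral)
    then show ?thesis using difference_entropy_upper_real[OF assms(2)] unfolding ent real by simp
  next
    case top
    then show ?thesis using difference_entropy_upper_infinity[OF assms(2)]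
      unfolding ent by (simp add: infinity_ennreal_def)
  qed
  have equality: "renyi_entropy M b \<alpha> (\<lambda>\<omega>. X \<omega> - Y \<omega>)
      = renyi_entropy M b \<alpha> X + ereal (real CARD('n) * log b 2)"
    if "2 \<le> \<alpha>" and e: "distributed M lborel X (\<lambda>x. ennreal (exp_density x))" for \<alpha> :: ennreal
  proof (rule antisym[OF high[OF that(1)]])
    have le: "log_concave_density (exp_density :: real ^ 'n \<Rightarrow> real)"
      by (rule log_concave_densityI[OF assms(1) e _ log_concave_exp_density]) (simp add: exp_density_def)
    show "renyi_entropy M b \<alpha> X + ereal (real CARD('n) * log b 2) \<le> renyi_entropy M b \<alpha> (\<lambda>\<omega>. X \<omega> - Y \<omega>)"
      unfolding entropies[OF le e]
      by (rule exp_density_difference_entropy_lower[OF le assms(2) that(1)])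
  qed
  have low: "renyi_entropy M b (ennreal \<alpha>) (\<lambda>\<omega>. X \<omega> - Y \<omega>)
      \<le> renyi_entropy M b (ennreal \<alpha>) X + ereal (real CARD('n)) * elog b (renyi_const \<alpha>)"
    if "0 \<le> \<alpha>" "\<alpha> \<le> 2" for \<alpha>
    using difference_entropy_upper_low_order[OF assms(2) that] unfolding ent by simp
  show ?thesis using high equality low by blast
qed

end
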